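(* Consider a query stream of rate $\lambda$ with sources $s_1,s_2$ and destination $d$, computed at a single node $n$ of a general network $\mathcal{G}$ (raw and processed packets may share links). Then, for every $\epsilon_B\in(0,1)$, the system is stable under policy $\pi_2$ with parameter $\epsilon_B$ for every query rate $$\lambda<\Big(1-\frac{\epsilon_B}{1+\epsilon_B}\Big)\lambda^* .$$
   Context: Network: $\mathcal{G}=(\mathcal{V},\mathcal{E})$ is a finite graph with undirected edges; the edge between $m$ and $k$ has a fixed integer capacity $R_{mk}=R_{km}$ (packets per slot), shared by the two directions. $s_1,s_2\in\mathcal{V}$ are the sources, $d\in\mathcal{V}$ the destination, $n\in\mathcal{V}$ the computation node, which can process at most $C_n$ (integer) pairs per slot. Queries: time is slotted; $A(t)$ queries arrive in slot $t$, where $A(t)$ is i.i.d. over time with values in the nonnegative integers, $\mathbb{E}[A(t)]=\lambda$, $\mathbb{E}[A(t)^2]<\infty$. Each query generates one raw packet at $s_1$ and one at $s_2$, both carrying the same tag (distinct queries have distinct tags). The two raw packets of a query must both be brought to $n$ and combined there into one processed packet, which must be delivered to $d$. Queues (lengths at slot $t$): $Q_k^{(i,n)}(t)$, $i=1,2$, counts raw packets from $s_i$ waiting at node $k$ on their way to $n$ (with $Q_n^{(i,n)}(t)=0$); $X_n^{(i)}(t)$, $i=1,2$, counts raw packets from $s_i$ that have reached $n$ and wait to be combined; $Y_n(t)$ is the length of an intermediate queue at $n$ holding processed packets not yet released into the network; $Q_k^{(0,n)}(t)$ counts released processed packets (useful or dummy) waiting at $k$ on their way to $d$ (with $Q_d^{(0,n)}(t)=0$).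 New raw packets join $Q_{s_i}^{(i,n)}$ (or $X_n^{(i)}$ if $s_i=n$). $P_n(t)$ is the number of tags for which both raw packets are present and waiting at $n$. Backpressure (BP) routing: in each slot and for each link $(m,k)$, choose the class $c^*_{mk}(t)$ maximizing $|Q_m^{(c)}(t)-Q_k^{(c)}(t)|$ over the classes $c\in\{(0,n),(1,n),(2,n)\}$, and set $U_{mk}^{(c)}(t)=R_{mk}$ if $c=c^*_{mk}(t)$ and $Q_m^{(c)}(t)>Q_k^{(c)}(t)$, and $U_{mk}^{(c)}(t)=0$ otherwise; any $U_{mk}^{(c)}(t)$ packets of class $c$ are then moved from $m$ to $k$ (if more service is allocated than packets available, only existing packets are moved). Policy $\pi_2$ (parameter $\epsilon_B\in(0,1)$), in each slot $t$: (1) route all packets by BP; (2) at node $n$ combine $\min\{P_n(t),C_n\}$ pairs of raw packets with equal tags and push the resulting processed packets into the queue of length $Y_n$; (3) release $F^{(n)}(t)=(1+B^{(n)}(t))A(t)$ packets from the queue of length $Y_n$ to the queue of length $Q_n^{(0,n)}$; if there are not enough processed packets in it, the shortfall is filled with dummy packets, which are routed exactly like processed packets. Here $B^{(n)}(t)$ is Bernoulli with success probability $\epsilon_B$, i.i.d. over time and independent of everything else. Stability: all queues are strongly stable, i.e. the quantity $\limsup_{T\to\infty}\frac1T\sum_{t=1}^T\mathbb{E}[\,\cdot\,]$ is finite for each of $Q_k^{(i,n)}(t)$ ($k\in\mathcal{V}$, $i\in\{0,1,2\}$), $X_n^{(i)}(t)$ ($i\in\{1,2\}$) and $Y_n(t)$.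 Flow region: for a finite set $\mathcal{C}$ of commodities (source–destination pairs), $\Lambda_{\mathcal{G}}(\mathcal{C})$ is the set of rate vectors $(\lambda^{(c)})_{c\in\mathcal{C}}$ for which there exist flows $f_{mk}^{(c)}\ge 0$ (for each edge and each of its two directions) such that for every $c$ and node $m$, $\sum_k f_{mk}^{(c)}-\sum_k f_{km}^{(c)}$ equals $\lambda^{(c)}$ if $m$ is the source of $c$, $-\lambda^{(c)}$ if $m$ is the destination of $c$, and $0$ otherwise; $f_{mk}^{(c)}=0$ whenever $m$ is the destination of $c$; and $\sum_{c}\big(f_{mk}^{(c)}+f_{km}^{(c)}\big)\le R_{mk}$ for each edge. A commodity whose source equals its destination requires no flow. $\lambda^*=\sup\{\lambda\ge0:\ (\lambda,\lambda,\lambda)\in\Lambda_{\mathcal{G}}(\mathcal{C}_3),\ \lambda\le C_n\}$, where $\mathcal{C}_3=\{(s_1,n),(s_2,n),(n,d)\}$. *)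

theory Defs
  imports "HOL-Probability.Probability"
begin

section \<open>Network and flow region\<close>

datatype stream = First | Second

text \<open>\<open>Raw i\<close> is the class \<open>(i,n)\<close> of raw packets of source \<open>s\<^sub>i\<close>; \<open>Proc\<close> is the class \<open>(0,n)\<close> of
  released processed packets, useful or dummy.\<close>

datatype cls = Proc | Raw stream

text \<open>The node set is the finite type \<open>'v\<close>. Nothing forces the two sources, the computation node
  and the destination to be distinct.\<close>

record 'v network =
  edges :: "('v \<times> 'v) set"
  cap :: "'v \<Rightarrow> 'v \<Rightarrow> nat"
  source :: "stream \<Rightarrow> 'v"
  cnode :: 'v
  dest :: 'v
  pair_rate :: nat

definition valid_network :: "'v network \<Rightarrow> bool" where
  "valid_network N \<longleftrightarrow> sym (edges N) \<and> irrefl (edges N) \<and>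
     (\<forall>(m, k) \<in> edges N. cap N m k = cap N k m)"

text \<open>The commodities are an indexed family with endpoints \<open>src c\<close> and \<open>dst c\<close>, so two commodities
  with equal endpoints (two streams generated at the same node) remain separate and their rates
  add up. There is no balance constraint if \<open>src c = dst c\<close>, so that the zero flow is admissible
  for such a commodity at any rate.\<close>

definition flow_region ::
  "('v::finite \<times> 'v) set \<Rightarrow> ('v \<Rightarrow> 'v \<Rightarrow> nat) \<Rightarrow> 'c set \<Rightarrow> ('c \<Rightarrow> 'v) \<Rightarrow> ('c \<Rightarrow> 'v) \<Rightarrow> ('c \<Rightarrow> real) set"
where
  "flow_region E R C src dst = {r. \<exists>f :: 'c \<Rightarrow> 'v \<Rightarrow> 'v \<Rightarrow> real.
     (\<forall>c\<in>C. \<forall>(m, k)\<in>E. 0 \<le> f c m k) \<and>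
     (\<forall>c\<in>C. src c \<noteq> dst c \<longrightarrow>
        (\<forall>m. (\<Sum>k | (m, k) \<in> E. f c m k) - (\<Sum>k | (k, m) \<in> E. f c k m) =
             (if m = src c then r c else if m = dst c then - r c else 0))) \<and>
     (\<forall>c\<in>C. \<forall>k. (dst c, k) \<in> E \<longrightarrow> f c (dst c) k = 0) \<and>
     (\<forall>(m, k)\<in>E. (\<Sum>c\<in>C. f c m k + f c k m) \<le> real (R m k))}"

primrec cls_src :: "'v network \<Rightarrow> cls \<Rightarrow> 'v" where
  "cls_src N Proc = cnode N"
| "cls_src N (Raw i) = source N i"

primrec cls_dst :: "'v network \<Rightarrow> cls \<Rightarrow> 'v" where
  "cls_dst N Proc = dest N"
| "cls_dst N (Raw i) = cnode N"

definition max_rate :: "'v::finite network \<Rightarrow> real" where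
  "max_rate N = Sup {r. 0 \<le> r \<and>
     (\<lambda>_. r) \<in> flow_region (edges N) (cap N) {Raw First, Raw Second, Proc} (cls_src N) (cls_dst N) \<and>
     r \<le> real (pair_rate N)}"

section \<open>One slot under policy \<open>\<pi>\<^sub>2\<close>\<close>

text \<open>The tag \<open>(t, j)\<close> belongs to the \<open>j\<close>-th query of slot \<open>t\<close>. Raw packets are identified with
  their tags. Processed packets enter the dynamics only through their number.\<close>

type_synonym tag = "nat \<times> nat"

record 'v state =
  raw_at :: "stream \<Rightarrow> 'v \<Rightarrow> tag set"
  arrived :: "stream \<Rightarrow> tag set"
  unreleased :: nat
  proc_at :: "'v \<Rightarrow> nat"

definition empty_state :: "'v state" where
  "empty_state = \<lparr>raw_at = (\<lambda>_ _. {}), arrived = (\<lambda>_. {}), unreleased = 0, proc_at = (\<lambda>_. 0)\<rparr>"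

primrec qlen :: "'v state \<Rightarrow> cls \<Rightarrow> 'v \<Rightarrow> nat" where
  "qlen S Proc k = proc_at S k"
| "qlen S (Raw i) k = card (raw_at S i k)"

definition xlen :: "'v state \<Rightarrow> stream \<Rightarrow> nat" where
  "xlen S i = card (arrived S i)"

definition ylen :: "'v state \<Rightarrow> nat" where
  "ylen S = unreleased S"

definition pairs_waiting :: "'v state \<Rightarrow> nat" where
  "pairs_waiting S = card (arrived S First \<inter> arrived S Second)"

text \<open>Ties in the maximization are resolved arbitrarily, by one class per undirected link.\<close>

definition bp_choice :: "'v network \<Rightarrow> 'v state \<Rightarrow> ('v \<Rightarrow> 'v \<Rightarrow> cls) \<Rightarrow> bool" where
  "bp_choice N S best \<longleftrightarrow> (\<forall>(m, k) \<in> edges N. best m k = best k m \<and>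
     (\<forall>c. \<bar>int (qlen S c m) - int (qlen S c k)\<bar>
          \<le> \<bar>int (qlen S (best m k) m) - int (qlen S (best m k) k)\<bar>))"

definition bp_service ::
  "'v network \<Rightarrow> 'v state \<Rightarrow> ('v \<Rightarrow> 'v \<Rightarrow> cls) \<Rightarrow> cls \<Rightarrow> 'v \<Rightarrow> 'v \<Rightarrow> nat" where
  "bp_service N S best c m k =
     (if (m, k) \<in> edges N \<and> best m k = c \<and> qlen S c k < qlen S c m then cap N m k else 0)"

definition feasible_moves ::
  "'v::finite network \<Rightarrow> 'v state \<Rightarrow> ('v \<Rightarrow> 'v \<Rightarrow> cls) \<Rightarrow> cls \<Rightarrow> ('v \<Rightarrow> 'v \<Rightarrow> nat) \<Rightarrow> bool" where
  "feasible_moves N S best c mv \<longleftrightarrow>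
     (\<forall>m k. mv m k \<le> bp_service N S best c m k) \<and>
     (\<forall>m. (\<Sum>k\<in>UNIV. mv m k) = min (qlen S c m) (\<Sum>k\<in>UNIV. bp_service N S best c m k))"

text \<open>\<open>pi2_step N t a b S S'\<close>: state \<open>S\<close> at the beginning of slot \<open>t\<close> can be followed by \<open>S'\<close> at the
  beginning of slot \<open>t + 1\<close> if \<open>a\<close> queries arrive and the release variable equals \<open>b\<close>. All
  operations of a slot act on the packets present at its beginning; packets that join a queue during
  the slot can be served from the next slot on. The relation leaves open all choices that the policy
  leaves open: the backpressure ties, which packets cross which link (sets \<open>M i m k\<close> of tags,
  numbers \<open>mv m k\<close> of processed packets), and which of the complete pairs are combined
  (set \<open>comb\<close>). The subtraction \<open>unreleased S - F\<close> is truncated: a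
  shortfall is made up by dummy packets.\<close>

definition pi2_step ::
  "'v::finite network \<Rightarrow> nat \<Rightarrow> nat \<Rightarrow> nat \<Rightarrow> 'v state \<Rightarrow> 'v state \<Rightarrow> bool" where
  "pi2_step N t a b S S' \<longleftrightarrow>
   (\<exists>best M mv comb.
      let new = {t} \<times> {..<a}; F = (1 + b) * a in
      bp_choice N S best \<and>
      (\<forall>i. (\<forall>m k. M i m k \<subseteq> raw_at S i m) \<and>
           (\<forall>m. disjoint_family (M i m)) \<and>
           feasible_moves N S best (Raw i) (\<lambda>m k. card (M i m k))) \<and>
      feasible_moves N S best Proc mv \<and>
      comb \<subseteq> arrived S First \<inter> arrived S Second \<and> card comb = min (pairs_waiting S) (pair_rate N) \<and>
      (\<forall>i k. raw_at S' i k =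
         (if k = cnode N then {}
          else (raw_at S i k - (\<Union>j. M i k j)) \<union> (\<Union>m. M i m k) \<union>
               (if k = source N i then new else {}))) \<and>
      (\<forall>i. arrived S' i =
         (arrived S i - comb) \<union> (\<Union>m. M i m (cnode N)) \<union>
         (if source N i = cnode N then new else {})) \<and>
      unreleased S' = (unreleased S - F) + card comb \<and>
      (\<forall>k. proc_at S' k =
         (if k = dest N then 0
          else proc_at S k - (\<Sum>j\<in>UNIV. mv k j) + (\<Sum>m\<in>UNIV. mv m k) +
               (if k = cnode N then F else 0))))"

section \<open>The controlled stochastic system\<close>

text \<open>\<open>F t\<close> is the information available at the beginning of slot \<open>t\<close>: the past arrivals and release
  variables, the state, and any extra randomness used by the open choices of the policy.
  Independence of \<open>(A t, B t)\<close> from \<open>F t\<close>, with the identical distributions and the independence of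
  \<open>A t\<close> from \<open>B t\<close>, makes both sequences i.i.d. and independent of each other; it also says that
  the choices made before slot \<open>t\<close> do not anticipate \<open>A t\<close> and \<open>B t\<close>.\<close>

locale pi2_system = prob_space M + filtration "space M" F
  for M :: "'w measure" and F :: "nat \<Rightarrow> 'w measure" +
  fixes N :: "'v::finite network"
    and rate :: real
    and eps :: real
    and A :: "nat \<Rightarrow> 'w \<Rightarrow> nat"
    and B :: "nat \<Rightarrow> 'w \<Rightarrow> nat"
    and S :: "nat \<Rightarrow> 'w \<Rightarrow> 'v state"
  assumes network: "valid_network N"
    and subalg: "\<And>t. subalgebra M (F t)"
    and A_adapted: "\<And>t. A t \<in> measurable (F (Suc t)) (count_space UNIV)"
    and B_adapted: "\<And>t. B t \<in> measurable (F (Suc t)) (count_space UNIV)"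
    and fresh: "\<And>t. indep_set (sets (F t))
          (sets (vimage_algebra (space M) (\<lambda>\<omega>. (A t \<omega>, B t \<omega>)) (count_space UNIV)))"
    and A_indep_B: "\<And>t. indep_var (count_space UNIV) (A t) (count_space UNIV) (B t)"
    and A_ident: "\<And>t. distr M (count_space UNIV) (A t) = distr M (count_space UNIV) (A 0)"
    and A_square_integrable: "\<And>t. integrable M (\<lambda>\<omega>. (real (A t \<omega>))\<^sup>2)"
    and A_mean: "\<And>t. expectation (\<lambda>\<omega>. real (A t \<omega>)) = rate"
    and B_range: "\<And>t \<omega>. \<omega> \<in> space M \<Longrightarrow> B t \<omega> \<in> {0, 1}"
    and B_prob: "\<And>t. prob {\<omega> \<in> space M. B t \<omega> = 1} = eps"
    and raw_adapted: "\<And>t i k x. Measurable.pred (F t) (\<lambda>\<omega>. x \<in> raw_at (S t \<omega>) i k)"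
    and arrived_adapted: "\<And>t i x. Measurable.pred (F t) (\<lambda>\<omega>. x \<in> arrived (S t \<omega>) i)"
    and unreleased_adapted: "\<And>t. (\<lambda>\<omega>. unreleased (S t \<omega>)) \<in> measurable (F t) (count_space UNIV)"
    and proc_adapted: "\<And>t k. (\<lambda>\<omega>. proc_at (S t \<omega>) k) \<in> measurable (F t) (count_space UNIV)"
    and initial: "\<And>\<omega>. \<omega> \<in> space M \<Longrightarrow> S 0 \<omega> = empty_state"
    and dynamics: "\<And>t \<omega>. \<omega> \<in> space M \<Longrightarrow> pi2_step N t (A t \<omega>) (B t \<omega>) (S t \<omega>) (S (Suc t) \<omega>)"

text \<open>Expectations are taken in \<open>[0, \<infinity>]\<close>, so an infinite mean queue length counts as unstable.\<close>

definition strongly_stable :: "'w measure \<Rightarrow> (nat \<Rightarrow> 'w \<Rightarrow> nat) \<Rightarrow> bool" where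
  "strongly_stable M q \<longleftrightarrow>
     limsup (\<lambda>T. (\<Sum>t = 1..T. \<integral>\<^sup>+\<omega>. of_nat (q t \<omega>) \<partial>M) / of_nat T) < (\<infinity> :: ennreal)"

definition system_stable :: "'w measure \<Rightarrow> (nat \<Rightarrow> 'w \<Rightarrow> 'v state) \<Rightarrow> bool" where
  "system_stable M S \<longleftrightarrow>
     (\<forall>c k. strongly_stable M (\<lambda>t \<omega>. qlen (S t \<omega>) c k)) \<and>
     (\<forall>i. strongly_stable M (\<lambda>t \<omega>. xlen (S t \<omega>) i)) \<and>
     strongly_stable M (\<lambda>t \<omega>. ylen (S t \<omega>))"

end

theory Submission
  imports Defs
begin

text \<open>Let \<open>\<rho> = (1 + \<epsilon>)\<lambda>\<close> and pick a feasible \<open>r > \<rho>\<close>. The released stream \<open>(1 + B)A\<close> is fresh in every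
  slot and has mean \<open>\<rho>\<close>, so the dummy packets decouple the network queues from the combination at \<open>n\<close>.
  For the sum of squared network queues, backpressure yields a drift of at most
  \<open>const - (1 - \<rho>/r) G\<close>, where \<open>G\<close> is the sum over the directed links of capacity times maximal
  queue difference: the flow of rate \<open>r\<close> shows \<open>2r \<Sum> (source queues) \<le> G\<close>. Along a path of positive
  capacity to the destination, \<open>G\<close> bounds every queue; nodes without such a path stay empty.

  Let \<open>Z\<close> be the number of tags not yet combined. Both raw packets of such a tag are at \<open>n\<close> unless
  one is still in the network, so \<open>Z \<le> P + (raw queues)\<close>; hence \<open>Z\<^sup>2\<close> has drift at most
  \<open>const - 2(C - \<lambda>)Z + 2C (raw queues)\<close>, and \<open>Z\<close> dominates \<open>X\<close>. Finally \<open>Y + Z\<close> changes by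
  \<open>A - min F Y\<close>, so that \<open>(Y + Z)\<^sup>2\<close> has drift at most \<open>const + 2\<lambda>Z - 2\<epsilon>\<lambda>Y\<close>.\<close>

section \<open>Flows and backpressure\<close>

instance stream :: finite
proof
  have "(UNIV :: stream set) \<subseteq> {First, Second}" using stream.exhaust by blast
  then show "finite (UNIV :: stream set)" by (rule finite_subset) simp
qed

lemma UNIV_cls: "UNIV = {Raw First, Raw Second, Proc}"
proof -
  have "c \<in> {Raw First, Raw Second, Proc}" for c
    by (cases c) (use stream.exhaust in auto)
  then show ?thesis by blast
qed

instance cls :: finite
  by standard (simp add: UNIV_cls)

lemma sum_cls: "(\<Sum>c\<in>UNIV. g c) = g (Raw First) + g (Raw Second) + g Proc"
  for g :: "cls \<Rightarrow> 'a::comm_monoid_add"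
  by (simp add: UNIV_cls add.assoc)

lemma sum_swap_sym:
  fixes g :: "'v::finite \<Rightarrow> 'v \<Rightarrow> real"
  assumes "sym E"
  shows "(\<Sum>(m, k)\<in>E. g m k) = (\<Sum>(m, k)\<in>E. g k m)"
proof -
  have "bij_betw prod.swap E E"
    using assms by (intro bij_betwI[of _ _ _ prod.swap]) (auto dest: symD)
  then show ?thesis
    by (subst sum.reindex_bij_betw[symmetric, of prod.swap E E]) (auto simp: case_prod_beta)
qed

lemma sum_edges_iterated:
  fixes g :: "'v::finite \<Rightarrow> 'v \<Rightarrow> real"
  shows "(\<Sum>(m, k)\<in>E. g m k) = (\<Sum>m\<in>UNIV. \<Sum>k | (m, k) \<in> E. g m k)"
    and "(\<Sum>(m, k)\<in>E. g m k) = (\<Sum>k\<in>UNIV. \<Sum>m | (m, k) \<in> E. g m k)"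
proof -
  have E: "E = Sigma UNIV (\<lambda>m. {k. (m, k) \<in> E})" by auto
  show 1: "(\<Sum>(m, k)\<in>E. g m k) = (\<Sum>m\<in>UNIV. \<Sum>k | (m, k) \<in> E. g m k)"
    by (subst E, subst sum.Sigma[symmetric]) auto
  also have "\<dots> = (\<Sum>k\<in>UNIV. \<Sum>m | (m, k) \<in> E. g m k)"
    using sum.swap_restrict[of UNIV UNIV g "\<lambda>m k. (m, k) \<in> E"] by simp
  finally show "(\<Sum>(m, k)\<in>E. g m k) = (\<Sum>k\<in>UNIV. \<Sum>m | (m, k) \<in> E. g m k)" .
qed

text \<open>Summation by parts on the graph. It serves both the balance equations of a flow, tested
  with a potential \<open>q\<close>, and the drift of squared queues under a service
  schedule.\<close>

lemma sum_net_outflow: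
  fixes f :: "'v::finite \<Rightarrow> 'v \<Rightarrow> real"
  shows "(\<Sum>m\<in>UNIV. q m * ((\<Sum>k | (m, k) \<in> E. f m k) - (\<Sum>k | (k, m) \<in> E. f k m))) =
         (\<Sum>(m, k)\<in>E. f m k * (q m - q k))"
proof -
  have "(\<Sum>(m, k)\<in>E. f m k * (q m - q k)) = (\<Sum>(m, k)\<in>E. q m * f m k) - (\<Sum>(m, k)\<in>E. q k * f m k)"
    by (simp add: sum_subtractf[symmetric] case_prod_beta algebra_simps)
  also have "(\<Sum>(m, k)\<in>E. q m * f m k) = (\<Sum>m\<in>UNIV. q m * (\<Sum>k | (m, k) \<in> E. f m k))"
    by (subst sum_edges_iterated(1)) (simp add: sum_distrib_left)
  also have "(\<Sum>(m, k)\<in>E. q k * f m k) = (\<Sum>m\<in>UNIV. q m * (\<Sum>k | (k, m) \<in> E. f k m))"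
    by (subst sum_edges_iterated(2)) (simp add: sum_distrib_left)
  finally show ?thesis by (simp add: right_diff_distrib sum_subtractf)
qed

section \<open>Flows tested against potentials\<close>

abbreviation region :: "'v::finite network \<Rightarrow> (cls \<Rightarrow> real) set" where
  "region N \<equiv> flow_region (edges N) (cap N) {Raw First, Raw Second, Proc} (cls_src N) (cls_dst N)"

text \<open>The balance equations in weak form: the test potential \<open>q\<close> vanishes at the
  destination, so only the source contributes. Later \<open>q\<close> is a vector of queue lengths
  or the indicator of a cut.\<close>

definition flow_of :: "'v::finite network \<Rightarrow> real \<Rightarrow> (cls \<Rightarrow> 'v \<Rightarrow> 'v \<Rightarrow> real) \<Rightarrow> bool" where
  "flow_of N r f \<longleftrightarrow>
     (\<forall>c. \<forall>(m, k)\<in>edges N. 0 \<le> f c m k) \<and>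
     (\<forall>c q. q (cls_dst N c) = 0 \<longrightarrow> cls_src N c \<noteq> cls_dst N c \<longrightarrow>
        (\<Sum>(m, k)\<in>edges N. f c m k * (q m - q k)) = r * q (cls_src N c)) \<and>
     (\<forall>(m, k)\<in>edges N. (\<Sum>c\<in>UNIV. f c m k + f c k m) \<le> real (cap N m k))"

lemma flow_ofD:
  assumes "flow_of N r f"
  shows "(m, k) \<in> edges N \<Longrightarrow> 0 \<le> f c m k"
    and "q (cls_dst N c) = 0 \<Longrightarrow> cls_src N c \<noteq> cls_dst N c \<Longrightarrow>
      (\<Sum>(m, k)\<in>edges N. f c m k * (q m - q k)) = r * q (cls_src N c)"
    and "(m, k) \<in> edges N \<Longrightarrow> (\<Sum>c\<in>UNIV. f c m k + f c k m) \<le> real (cap N m k)"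
  using assms unfolding flow_of_def by (blast, simp, blast)

lemma regionE:
  assumes "(\<lambda>_. r) \<in> region N"
  obtains f where "flow_of N r f"
proof -
  obtain f where F: "(\<forall>c. \<forall>(m, k)\<in>edges N. 0 \<le> f c m k) \<and>
     (\<forall>c. cls_src N c \<noteq> cls_dst N c \<longrightarrow>
        (\<forall>m. (\<Sum>k | (m, k) \<in> edges N. f c m k) - (\<Sum>k | (k, m) \<in> edges N. f c k m) =
             (if m = cls_src N c then r else if m = cls_dst N c then - r else 0))) \<and>
     (\<forall>(m, k)\<in>edges N. (\<Sum>c\<in>UNIV. f c m k + f c k m) \<le> real (cap N m k))"
    using assms unfolding flow_region_def UNIV_cls[symmetric] by (simp only: ball_UNIV mem_Collect_eq) blast
  then have bal: "\<And>c m. cls_src N c \<noteq> cls_dst N c \<Longrightarrow>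
        (\<Sum>k | (m, k) \<in> edges N. f c m k) - (\<Sum>k | (k, m) \<in> edges N. f c k m) =
             (if m = cls_src N c then r else if m = cls_dst N c then - r else 0)"
    by blast
  have "(\<Sum>(m, k)\<in>edges N. f c m k * (q m - q k)) = r * q (cls_src N c)"
    if "q (cls_dst N c) = 0" "cls_src N c \<noteq> cls_dst N c" for c and q :: "'a \<Rightarrow> real"
  proof -
    have "(\<Sum>(m, k)\<in>edges N. f c m k * (q m - q k)) =
        (\<Sum>m\<in>UNIV. q m * (if m = cls_src N c then r else if m = cls_dst N c then - r else 0))"
      by (simp only: sum_net_outflow[symmetric] bal[OF that(2)])
    also have "\<dots> = (\<Sum>m\<in>UNIV. if m = cls_src N c then r * q m else 0)"
      using that by (intro sum.cong) auto
    finally show ?thesis by simp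
  qed
  with F have "flow_of N r f" unfolding flow_of_def by blast
  then show ?thesis by (rule that)
qed

text \<open>A flow of rate \<open>r\<close> carries each unit from potential
  \<open>q c (cls_src N c)\<close> down to 0, and an edge accounts for a descent of at most
  \<open>w\<close>; the capacities limit how much flow can use an edge. The factor 2 arises because
  \<open>edges\<close> holds both orientations of a link, each with the full shared
  capacity.\<close>

lemma flow_le_weight:
  fixes N :: "'v::finite network" and q :: "cls \<Rightarrow> 'v \<Rightarrow> real"
  assumes N: "valid_network N" and r: "(\<lambda>_. r) \<in> region N"
    and dst: "\<And>c. q c (cls_dst N c) = 0"
    and w: "\<And>c m k. \<bar>q c m - q c k\<bar> \<le> w m k"
  shows "2 * r * (\<Sum>c\<in>UNIV. q c (cls_src N c)) \<le> (\<Sum>(m, k)\<in>edges N. real (cap N m k) * w m k)"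
proof -
  have sym: "sym (edges N)" using N by (simp add: valid_network_def)
  obtain f where "flow_of N r f" using regionE[OF r] .
  note f = flow_ofD(1)[OF this] and bal = flow_ofD(2)[OF this] and cap = flow_ofD(3)[OF this]
  have per_class: "2 * (r * q c (cls_src N c)) \<le> (\<Sum>(m, k)\<in>edges N. (f c m k + f c k m) * w m k)" for c
  proof (cases "cls_src N c = cls_dst N c")
    case True
    have "0 \<le> (\<Sum>(m, k)\<in>edges N. (f c m k + f c k m) * w m k)"
    proof (rule sum_nonneg, clarify)
      fix m k assume mk: "(m, k) \<in> edges N"
      with sym have "(k, m) \<in> edges N" by (auto dest: symD)
      moreover have "0 \<le> w m k" using w[of c m k] by linarith
      ultimately show "0 \<le> (f c m k + f c k m) * w m k" using f mk by (simp add: add_nonneg_nonneg)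
    qed
    with True dst show ?thesis by simp
  next
    case False
    have eq: "(\<Sum>(m, k)\<in>edges N. f c m k * (q c m - q c k)) = r * q c (cls_src N c)"
      by (rule bal) (use dst False in auto)
    \<comment> \<open>The second sum is the first with the orientation reversed. Together they
      produce the joint flow \<open>f c m k + f c k m\<close>, which the capacity constraint
      bounds.\<close>
    have "2 * (r * q c (cls_src N c)) =
        (\<Sum>(m, k)\<in>edges N. f c m k * (q c m - q c k)) + (\<Sum>(m, k)\<in>edges N. f c k m * (q c k - q c m))"
      using eq sum_swap_sym[OF sym, of "\<lambda>m k. f c m k * (q c m - q c k)"] by simp
    also have "\<dots> = (\<Sum>(m, k)\<in>edges N. f c m k * (q c m - q c k) + f c k m * (q c k - q c m))"
      by (simp add: sum.distrib[symmetric] case_prod_beta)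
    also have "\<dots> \<le> (\<Sum>(m, k)\<in>edges N. (f c m k + f c k m) * w m k)"
    proof (rule sum_mono, clarify)
      fix m k assume mk: "(m, k) \<in> edges N"
      with sym have km: "(k, m) \<in> edges N" by (auto dest: symD)
      have "f c m k * (q c m - q c k) \<le> f c m k * w m k"
        using w[of c m k] f[OF mk] by (intro mult_left_mono) auto
      moreover have "f c k m * (q c k - q c m) \<le> f c k m * w m k"
        using w[of c m k] f[OF km] by (intro mult_left_mono) auto
      ultimately show "f c m k * (q c m - q c k) + f c k m * (q c k - q c m) \<le> (f c m k + f c k m) * w m k"
        by (simp add: algebra_simps)
    qed
    finally show ?thesis .
  qed
  have "2 * r * (\<Sum>c\<in>UNIV. q c (cls_src N c)) = (\<Sum>c\<in>UNIV. 2 * (r * q c (cls_src N c)))"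
    by (simp add: sum_distrib_left mult.assoc)
  also have "\<dots> \<le> (\<Sum>c\<in>UNIV. \<Sum>(m, k)\<in>edges N. (f c m k + f c k m) * w m k)"
    by (intro sum_mono per_class)
  also have "\<dots> = (\<Sum>(m, k)\<in>edges N. (\<Sum>c\<in>UNIV. f c m k + f c k m) * w m k)"
    by (subst sum.swap) (simp add: sum_distrib_right case_prod_beta)
  also have "\<dots> \<le> (\<Sum>(m, k)\<in>edges N. real (cap N m k) * w m k)"
  proof (rule sum_mono, clarify)
    fix m k assume mk: "(m, k) \<in> edges N"
    have "0 \<le> w m k" using w[of Proc m k] by linarith
    then show "(\<Sum>c\<in>UNIV. f c m k + f c k m) * w m k \<le> real (cap N m k) * w m k"
      by (intro mult_right_mono cap mk)
  qed
  finally show ?thesis .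
qed

section \<open>Connectivity through links of positive capacity\<close>

definition links :: "'v network \<Rightarrow> ('v \<times> 'v) set" where
  "links N = {(m, k) \<in> edges N. 0 < cap N m k}"

lemma links_sym: "valid_network N \<Longrightarrow> (m, k) \<in> links N \<Longrightarrow> (k, m) \<in> links N"
  unfolding valid_network_def links_def by (auto dest: symD)

text \<open>Ensures that no class receives packets at a node from which its destination cannot be
  reached; queues at such nodes then stay empty.\<close>

lemma source_linked:
  fixes N :: "'v::finite network"
  assumes N: "valid_network N" and r: "(\<lambda>_. r) \<in> region N" and "0 < r"
  shows "(cls_src N c, cls_dst N c) \<in> (links N)\<^sup>*"
proof (rule ccontr)
  assume unlinked: "(cls_src N c, cls_dst N c) \<notin> (links N)\<^sup>*"
  then have ne: "cls_src N c \<noteq> cls_dst N c" by auto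
  have sym: "sym (edges N)" using N by (simp add: valid_network_def)
  obtain f where "flow_of N r f" using regionE[OF r] .
  note f = flow_ofD(1)[OF this] and bal = flow_ofD(2)[OF this] and cap = flow_ofD(3)[OF this]
  \<comment> \<open>No flow crosses the boundary of the component of the destination: test with its complement.\<close>
  define q :: "'v \<Rightarrow> real" where "q m = of_bool ((m, cls_dst N c) \<notin> (links N)\<^sup>*)" for m
  have "f c m k * (q m - q k) = 0" if mk: "(m, k) \<in> edges N" for m k
  proof (cases "(m, k) \<in> links N")
    case True
    have "(m, d) \<in> (links N)\<^sup>* \<longleftrightarrow> (k, d) \<in> (links N)\<^sup>*" for d
      using True links_sym[OF N True] by (blast intro: converse_rtrancl_into_rtrancl)
    then show ?thesis by (simp add: q_def)
  next
    case False
    have km: "(k, m) \<in> edges N" using mk sym by (auto dest: symD)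
    have "f c m k + f c k m \<le> (\<Sum>c\<in>UNIV. f c m k + f c k m)"
      by (rule member_le_sum) (auto intro: add_nonneg_nonneg f mk km)
    also have "\<dots> \<le> 0" using cap[OF mk] False mk by (simp add: links_def)
    finally have "f c m k = 0" using f[OF mk, of c] f[OF km, of c] by linarith
    then show ?thesis by simp
  qed
  then have "(\<Sum>(m, k)\<in>edges N. f c m k * (q m - q k)) = 0"
    by (intro sum.neutral) auto
  moreover have "(\<Sum>(m, k)\<in>edges N. f c m k * (q m - q k)) = r * q (cls_src N c)"
    by (rule bal) (use ne in \<open>auto simp: q_def\<close>)
  moreover have "q (cls_src N c) = 1" using unlinked by (simp add: q_def)
  ultimately show False using \<open>0 < r\<close> by simp
qed

text \<open>Telescoping along a path; \<open>n\<close> is its length. Capacities are integers, so on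
  a link \<open>cap\<close> is at least 1 and each increment is bounded by its own term of the sum.
  Since \<open>n\<close> is fixed before \<open>q\<close> and \<open>w\<close>, one constant serves
  all states.\<close>

lemma linked_le_weight:
  fixes N :: "'v::finite network"
  assumes "(k, d) \<in> (links N)\<^sup>*"
  obtains n :: nat where "\<And>(q :: 'v \<Rightarrow> real) w. q d = 0 \<Longrightarrow> (\<And>m k. \<bar>q m - q k\<bar> \<le> w m k) \<Longrightarrow>
    q k \<le> real n * (\<Sum>(m, k)\<in>edges N. real (cap N m k) * w m k)"
proof -
  have "\<exists>n::nat. \<forall>(q :: 'v \<Rightarrow> real) w. q d = 0 \<longrightarrow> (\<forall>m k. \<bar>q m - q k\<bar> \<le> w m k) \<longrightarrow>
    q k \<le> real n * (\<Sum>(m, k)\<in>edges N. real (cap N m k) * w m k)"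
    using assms
  proof (induction rule: converse_rtrancl_induct)
    case base
    show ?case by (rule exI[of _ 0]) simp
  next
    case (step x y)
    then obtain n :: nat where n: "\<And>(q :: 'v \<Rightarrow> real) w. q d = 0 \<Longrightarrow> (\<And>m k. \<bar>q m - q k\<bar> \<le> w m k) \<Longrightarrow>
      q y \<le> real n * (\<Sum>(m, k)\<in>edges N. real (cap N m k) * w m k)" by blast
    have "q x \<le> real (Suc n) * (\<Sum>(m, k)\<in>edges N. real (cap N m k) * w m k)"
      if q: "q d = 0" and w: "\<And>m k. \<bar>q m - q k\<bar> \<le> w m k" for q :: "'v \<Rightarrow> real" and w
    proof -
      have w0: "0 \<le> w m k" for m k using w[of m k] by linarith
      have xy: "(x, y) \<in> edges N" "1 \<le> cap N x y" using step.hyps by (auto simp: links_def)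
      have "q x - q y \<le> w x y" using w[of x y] by linarith
      also have "1 * w x y \<le> real (cap N x y) * w x y"
        using xy w0[of x y] by (intro mult_right_mono) auto
      then have "w x y \<le> real (cap N x y) * w x y" by simp
      also have "\<dots> \<le> (\<Sum>(m, k)\<in>edges N. real (cap N m k) * w m k)"
        using member_le_sum[of "(x, y)" "edges N" "\<lambda>(m, k). real (cap N m k) * w m k"] xy w0 by auto
      finally show ?thesis using n[of q w, OF q w] by (simp add: algebra_simps)
    qed
    then show ?case by blast
  qed
  then show ?thesis using that by blast
qed

section \<open>Backpressure as maximization of the differential backlog\<close>

definition weight :: "'v state \<Rightarrow> 'v \<Rightarrow> 'v \<Rightarrow> real" where
  "weight S m k = max \<bar>real (qlen S Proc m) - real (qlen S Proc k)\<bar>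
     (max \<bar>real (qlen S (Raw First) m) - real (qlen S (Raw First) k)\<bar>
          \<bar>real (qlen S (Raw Second) m) - real (qlen S (Raw Second) k)\<bar>)"

text \<open>In a valid network this is twice the optimal value of the max-weight problem that
  backpressure solves, since each link is counted in both orientations.\<close>

definition backlog_gap :: "'v::finite network \<Rightarrow> 'v state \<Rightarrow> real" where
  "backlog_gap N S = (\<Sum>(m, k)\<in>edges N. real (cap N m k) * weight S m k)"

lemma qlen_diff_le_weight: "\<bar>real (qlen S c m) - real (qlen S c k)\<bar> \<le> weight S m k"
proof -
  have "c \<in> {Raw First, Raw Second, Proc}" by (simp flip: UNIV_cls)
  then show ?thesis by (auto simp: weight_def)
qed

text \<open>Summation by parts turns the queue-weighted net service into a sum over edges. Each link
  spends its capacity on a class with the largest difference, from the longer to the shorter queue,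
  so it contributes capacity times that difference. Doubling matches the two orientations in
  \<open>backlog_gap\<close>.\<close>

lemma bp_drift:
  fixes N :: "'v::finite network"
  assumes N: "valid_network N" and bp: "bp_choice N S best"
  shows "backlog_gap N S \<le> 2 * (\<Sum>c\<in>UNIV. \<Sum>m\<in>UNIV. real (qlen S c m) *
    ((\<Sum>k\<in>UNIV. real (bp_service N S best c m k)) - (\<Sum>k\<in>UNIV. real (bp_service N S best c k m))))"
proof -
  have sym: "sym (edges N)" using N by (simp add: valid_network_def)
  define u where "u c m k = real (bp_service N S best c m k)" for c m k
  define Q where "Q c m = real (qlen S c m)" for c m
  have restrict: "(\<Sum>k\<in>UNIV. u c m k) = (\<Sum>k | (m, k) \<in> edges N. u c m k)"
    "(\<Sum>k\<in>UNIV. u c k m) = (\<Sum>k | (k, m) \<in> edges N. u c k m)" for c m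
    by (rule sum.mono_neutral_right; auto simp: u_def bp_service_def)+
  have "2 * (\<Sum>c\<in>UNIV. \<Sum>m\<in>UNIV. Q c m * ((\<Sum>k\<in>UNIV. u c m k) - (\<Sum>k\<in>UNIV. u c k m)))
      = 2 * (\<Sum>c\<in>UNIV. \<Sum>(m, k)\<in>edges N. u c m k * (Q c m - Q c k))"
    by (simp only: restrict sum_net_outflow)
  also have "\<dots> = (\<Sum>c\<in>UNIV. (\<Sum>(m, k)\<in>edges N. u c m k * (Q c m - Q c k))
         + (\<Sum>(m, k)\<in>edges N. u c k m * (Q c k - Q c m)))"
    by (simp only: mult_2 sum.distrib
          sum_swap_sym[OF sym, of "\<lambda>m k. u c k m * (Q c k - Q c m)" for c])
  also have "\<dots> = (\<Sum>(m, k)\<in>edges N. \<Sum>c\<in>UNIV. u c m k * (Q c m - Q c k) + u c k m * (Q c k - Q c m))"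
    by (simp add: sum.distrib[symmetric] case_prod_beta) (rule sum.swap)
  also have "\<dots> \<ge> backlog_gap N S"
    unfolding backlog_gap_def
  proof (rule sum_mono, clarify)
    fix m k assume mk: "(m, k) \<in> edges N"
    then have km: "(k, m) \<in> edges N" using sym by (auto dest: symD)
    define b where "b = best m k"
    have b: "best k m = b" "cap N k m = cap N m k"
      and max: "\<And>c. \<bar>int (qlen S c m) - int (qlen S c k)\<bar> \<le> \<bar>int (qlen S b m) - int (qlen S b k)\<bar>"
      using bp N mk unfolding bp_choice_def valid_network_def b_def by fastforce+
    have max': "\<bar>Q c m - Q c k\<bar> \<le> \<bar>Q b m - Q b k\<bar>" for c
      using max[of c] unfolding Q_def by linarith
    have "weight S m k \<le> \<bar>Q b m - Q b k\<bar>"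
      using max'[of Proc] max'[of "Raw First"] max'[of "Raw Second"] unfolding weight_def Q_def by simp
    then have "real (cap N m k) * weight S m k \<le> real (cap N m k) * \<bar>Q b m - Q b k\<bar>"
      by (intro mult_left_mono) auto
    \<comment> \<open>Only the direction towards the shorter queue is served, so at most one of the
      two terms is nonzero; it equals capacity times the absolute difference.\<close>
    also have "\<dots> = u b m k * (Q b m - Q b k) + u b k m * (Q b k - Q b m)"
      using mk km b unfolding u_def Q_def bp_service_def b_def[symmetric] by (auto simp: abs_if)
    also have "\<dots> = (\<Sum>c\<in>UNIV. if c = b then u c m k * (Q c m - Q c k) + u c k m * (Q c k - Q c m) else 0)"
      by simp
    also have "\<dots> = (\<Sum>c\<in>UNIV. u c m k * (Q c m - Q c k) + u c k m * (Q c k - Q c m))"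
      using b by (intro sum.cong) (auto simp: u_def bp_service_def b_def)
    finally show "real (cap N m k) * weight S m k \<le>
      (\<Sum>c\<in>UNIV. u c m k * (Q c m - Q c k) + u c k m * (Q c k - Q c m))" .
  qed
  finally show ?thesis unfolding u_def Q_def by simp
qed

section \<open>One slot\<close>

text \<open>The body of \<open>pi2_step\<close> with the choices left open by the policy as
  arguments, so that its conjuncts can be used one by one.\<close>

definition pi2_moves :: "'v::finite network \<Rightarrow> nat \<Rightarrow> nat \<Rightarrow> nat \<Rightarrow> 'v state \<Rightarrow> 'v state \<Rightarrow>
    ('v \<Rightarrow> 'v \<Rightarrow> cls) \<Rightarrow> (stream \<Rightarrow> 'v \<Rightarrow> 'v \<Rightarrow> tag set) \<Rightarrow> ('v \<Rightarrow> 'v \<Rightarrow> nat) \<Rightarrow> tag set \<Rightarrow> bool" where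
  "pi2_moves N t a b S S' best M mv comb \<longleftrightarrow>
      bp_choice N S best \<and>
      (\<forall>i. (\<forall>m k. M i m k \<subseteq> raw_at S i m) \<and>
           (\<forall>m. disjoint_family (M i m)) \<and>
           feasible_moves N S best (Raw i) (\<lambda>m k. card (M i m k))) \<and>
      feasible_moves N S best Proc mv \<and>
      comb \<subseteq> arrived S First \<inter> arrived S Second \<and> card comb = min (pairs_waiting S) (pair_rate N) \<and>
      (\<forall>i k. raw_at S' i k =
         (if k = cnode N then {}
          else (raw_at S i k - (\<Union>j. M i k j)) \<union> (\<Union>m. M i m k) \<union>
               (if k = source N i then {t} \<times> {..<a} else {}))) \<and>
      (\<forall>i. arrived S' i =
         (arrived S i - comb) \<union> (\<Union>m. M i m (cnode N)) \<union>
         (if source N i = cnode N then {t} \<times> {..<a} else {})) \<and>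
      unreleased S' = (unreleased S - (1 + b) * a) + card comb \<and>
      (\<forall>k. proc_at S' k =
         (if k = dest N then 0
          else proc_at S k - (\<Sum>j\<in>UNIV. mv k j) + (\<Sum>m\<in>UNIV. mv m k) +
               (if k = cnode N then (1 + b) * a else 0)))"

lemma pi2_step_iff: "pi2_step N t a b S S' \<longleftrightarrow> (\<exists>best M mv comb. pi2_moves N t a b S S' best M mv comb)"
  unfolding pi2_step_def pi2_moves_def Let_def ..

lemma pi2_movesD:
  assumes "pi2_moves N t a b S S' best M mv comb"
  shows "bp_choice N S best"
    and "M i m k \<subseteq> raw_at S i m"
    and "disjoint_family (M i m)"
    and "feasible_moves N S best (Raw i) (\<lambda>m k. card (M i m k))"
    and "feasible_moves N S best Proc mv"
    and "comb \<subseteq> arrived S First \<inter> arrived S Second"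
    and "card comb = min (pairs_waiting S) (pair_rate N)"
    and "raw_at S' i k =
         (if k = cnode N then {}
          else (raw_at S i k - (\<Union>j. M i k j)) \<union> (\<Union>m. M i m k) \<union>
               (if k = source N i then {t} \<times> {..<a} else {}))"
    and "arrived S' i =
         (arrived S i - comb) \<union> (\<Union>m. M i m (cnode N)) \<union>
         (if source N i = cnode N then {t} \<times> {..<a} else {})"
    and "unreleased S' = (unreleased S - (1 + b) * a) + card comb"
    and "proc_at S' k =
         (if k = dest N then 0
          else proc_at S k - (\<Sum>j\<in>UNIV. mv k j) + (\<Sum>m\<in>UNIV. mv m k) +
               (if k = cnode N then (1 + b) * a else 0))"
  using assms unfolding pi2_moves_def by (elim conjE, simp only:)+

section \<open>Tags of open queries\<close>

definition in_system :: "'v state \<Rightarrow> stream \<Rightarrow> tag set" where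
  "in_system S i = (\<Union>k. raw_at S i k) \<union> arrived S i"

text \<open>On \<open>consistent\<close> states both streams carry the same tags, so
  \<open>First\<close> stands for either one and the value is the number of queries not yet
  combined.\<close>

definition backlog :: "'v state \<Rightarrow> nat" where
  "backlog S = card (in_system S First)"

text \<open>Invariant of the reachable states. The bound on the tags makes those of slot
  \<open>t\<close> new, disjointness puts every raw packet at one place only, and the equality of
  the tag sets expresses that both packets of a query enter and leave together. Finiteness keeps
  \<open>card\<close> meaningful.\<close>

definition consistent :: "'v network \<Rightarrow> nat \<Rightarrow> 'v state \<Rightarrow> bool" where
  "consistent N t S \<longleftrightarrow>
     (\<forall>i. finite (in_system S i) \<and> in_system S i \<subseteq> {..<t} \<times> UNIV \<and>
          raw_at S i (cnode N) = {} \<and> disjoint_family (raw_at S i) \<and>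
          (\<forall>k. raw_at S i k \<inter> arrived S i = {})) \<and>
     in_system S First = in_system S Second \<and> proc_at S (dest N) = 0"

lemma consistentD:
  assumes "consistent N t S"
  shows "finite (in_system S i)" "in_system S i \<subseteq> {..<t} \<times> UNIV" "raw_at S i (cnode N) = {}"
    "disjoint_family (raw_at S i)" "raw_at S i k \<inter> arrived S i = {}"
    "in_system S i = in_system S First" "proc_at S (dest N) = 0" "finite (raw_at S i k)" "finite (arrived S i)"
proof -
  show 1: "finite (in_system S i)" and "in_system S i \<subseteq> {..<t} \<times> UNIV" "raw_at S i (cnode N) = {}"
    "disjoint_family (raw_at S i)" "raw_at S i k \<inter> arrived S i = {}" "proc_at S (dest N) = 0"
    using assms unfolding consistent_def by blast+
  show "in_system S i = in_system S First"
    using assms unfolding consistent_def by (cases i) auto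
  show "finite (raw_at S i k)" by (rule finite_subset[OF _ 1]) (auto simp: in_system_def)
  show "finite (arrived S i)" by (rule finite_subset[OF _ 1]) (auto simp: in_system_def)
qed

lemma consistent_empty: "consistent N 0 empty_state"
  by (auto simp: consistent_def empty_state_def in_system_def disjoint_family_on_def)

lemma qlen_dst: "consistent N t S \<Longrightarrow> qlen S c (cls_dst N c) = 0"
  by (cases c) (auto simp: consistentD)

text \<open>Raw packets are moved but neither copied nor lost, so a tag enters a stream only on
  arrival and leaves it only by combination, then for both streams at once. This is the fact
  \<open>sys\<close>, on which both parts rest.\<close>

lemma consistent_step:
  assumes c: "consistent N t S" and step: "pi2_step N t a b S S'"
  shows "consistent N (Suc t) S'"
    and "\<exists>comb \<subseteq> in_system S First. card comb = min (pairs_waiting S) (pair_rate N) \<and>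
      in_system S' First = (in_system S First - comb) \<union> {t} \<times> {..<a} \<and>
      unreleased S' = (unreleased S - (1 + b) * a) + card comb"
proof -
  from step obtain best M mv comb where "pi2_moves N t a b S S' best M mv comb"
    unfolding pi2_step_iff by blast
  note sub = pi2_movesD(2)[OF this] and disj = pi2_movesD(3)[OF this] and comb = pi2_movesD(6)[OF this]
    and card = pi2_movesD(7)[OF this] and raw = pi2_movesD(8)[OF this] and arr = pi2_movesD(9)[OF this]
    and unrel = pi2_movesD(10)[OF this] and proc = pi2_movesD(11)[OF this]
  define new where "new = {t} \<times> {..<a}"
  have comb': "comb \<subseteq> arrived S i" for i using comb by (cases i) auto
  have raw_unique: "k = k'" if "x \<in> raw_at S i k" "x \<in> raw_at S i k'" for x i k k'
    using that consistentD(4)[OF c, of i] by (auto simp: disjoint_family_on_def)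
  \<comment> \<open>A tag sits at one node and so has one origin, and the sets leaving that origin
    are disjoint.\<close>
  have move_unique: "k = k'" if "x \<in> M i m k" "x \<in> M i m' k'" for x i m m' k k'
  proof -
    have "m = m'" using that sub raw_unique by (meson subsetD)
    then show ?thesis using that disj[of i m] by (auto simp: disjoint_family_on_def)
  qed
  have not_arrived: "x \<notin> arrived S i" if "x \<in> raw_at S i k" for x i k
    using that consistentD(5)[OF c] by blast
  have moved_raw: "x \<in> raw_at S i m" if "x \<in> M i m k" for x i m k using that sub by blast
  have not_new: "x \<notin> new" if "x \<in> in_system S i" for x i
    using that consistentD(2)[OF c, of i] by (auto simp: new_def)
  have raw_old: "x \<in> in_system S i" if "x \<in> raw_at S i k" for x i k
    using that by (auto simp: in_system_def)
  have arr_old: "x \<in> in_system S i" if "x \<in> arrived S i" for x i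
    using that by (auto simp: in_system_def)
  have raw': "x \<in> raw_at S' i k \<longleftrightarrow> k \<noteq> cnode N \<and>
      ((x \<in> raw_at S i k \<and> (\<forall>j. x \<notin> M i k j)) \<or> (\<exists>m. x \<in> M i m k) \<or> (k = source N i \<and> x \<in> new))" for x i k
    by (auto simp: raw new_def)
  have arr': "x \<in> arrived S' i \<longleftrightarrow> (x \<in> arrived S i \<and> x \<notin> comb) \<or> (\<exists>m. x \<in> M i m (cnode N)) \<or>
      (source N i = cnode N \<and> x \<in> new)" for x i
    by (auto simp: arr new_def)
  have sys: "in_system S' i = (in_system S i - comb) \<union> new" for i
  proof (intro set_eqI iffI)
    fix x assume "x \<in> in_system S' i"
    then consider k where "x \<in> raw_at S' i k" | "x \<in> arrived S' i" by (auto simp: in_system_def)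
    then have "(x \<in> arrived S i \<and> x \<notin> comb) \<or> (\<exists>m. x \<in> raw_at S i m) \<or> x \<in> new"
      by cases (auto simp: raw' arr' dest: moved_raw)
    then show "x \<in> (in_system S i - comb) \<union> new"
      using raw_old arr_old not_arrived comb' by blast
  next
    fix x assume "x \<in> (in_system S i - comb) \<union> new"
    then consider "x \<in> arrived S i" "x \<notin> comb" | k where "x \<in> raw_at S i k" | "x \<in> new"
      by (auto simp: in_system_def)
    then show "x \<in> in_system S' i"
    proof cases
      case 1 then show ?thesis by (auto simp: in_system_def arr')
    next
      case (2 k)
      then have "k \<noteq> cnode N" using consistentD(3)[OF c] by auto
      \<comment> \<open>A raw packet stays, moves to another node, or moves to
        \<open>cnode N\<close>; in the last case it appears in \<open>arrived S' i\<close>, because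
        \<open>raw_at S' i (cnode N)\<close> is kept empty.\<close>
      with 2 have "(\<exists>k. x \<in> raw_at S' i k) \<or> x \<in> arrived S' i"
        unfolding raw' arr' by metis
      then show ?thesis by (auto simp: in_system_def)
    next
      case 3
      then have "x \<in> raw_at S' i (source N i) \<or> x \<in> arrived S' i"
        unfolding raw' arr' by metis
      then show ?thesis by (auto simp: in_system_def)
    qed
  qed
  have "disjoint_family (raw_at S' i)" for i
  proof (unfold disjoint_family_on_def, intro ballI impI, rule ccontr)
    fix k k' assume kk: "k \<noteq> k'" and "raw_at S' i k \<inter> raw_at S' i k' \<noteq> {}"
    then obtain x where "x \<in> raw_at S' i k" "x \<in> raw_at S' i k'" by blast
    with kk show False unfolding raw'
      by (metis moved_raw raw_old not_new raw_unique move_unique)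
  qed
  moreover have "raw_at S' i k \<inter> arrived S' i = {}" for i k
  proof (rule ccontr)
    assume "raw_at S' i k \<inter> arrived S' i \<noteq> {}"
    then obtain x where "x \<in> raw_at S' i k" "x \<in> arrived S' i" by blast
    then show False unfolding raw' arr'
      by (metis moved_raw raw_old arr_old not_new raw_unique move_unique not_arrived)
  qed
  moreover have "finite (in_system S' i)" "in_system S' i \<subseteq> {..<Suc t} \<times> UNIV" for i
    using consistentD(1,2)[OF c, of i] unfolding sys by (auto simp: new_def)
  moreover have "in_system S' First = in_system S' Second"
    using sys consistentD(6)[OF c, of Second] by simp
  moreover have "raw_at S' i (cnode N) = {}" for i by (simp add: raw)
  moreover have "proc_at S' (dest N) = 0" by (simp add: proc)
  ultimately show "consistent N (Suc t) S'" unfolding consistent_def by blast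
  have "comb \<subseteq> in_system S First" using comb by (auto simp: in_system_def)
  with card sys[of First] unrel show "\<exists>comb \<subseteq> in_system S First. card comb = min (pairs_waiting S) (pair_rate N) \<and>
      in_system S' First = (in_system S First - comb) \<union> {t} \<times> {..<a} \<and>
      unreleased S' = (unreleased S - (1 + b) * a) + card comb"
    unfolding new_def by blast
qed

text \<open>Conservation of open queries, in additive form to avoid truncated subtraction. New tags
  have first component \<open>t\<close> and old ones a smaller one, so the cardinalities add
  up.\<close>

lemma backlog_step:
  assumes "consistent N t S" and "pi2_step N t a b S S'"
  shows "backlog S' + min (pairs_waiting S) (pair_rate N) = backlog S + a"
    and "unreleased S' = (unreleased S - (1 + b) * a) + min (pairs_waiting S) (pair_rate N)"
proof -
  obtain comb where sub: "comb \<subseteq> in_system S First" and card: "card comb = min (pairs_waiting S) (pair_rate N)"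
    and sys: "in_system S' First = (in_system S First - comb) \<union> {t} \<times> {..<a}"
    and unrel: "unreleased S' = (unreleased S - (1 + b) * a) + card comb"
    using consistent_step(2)[OF assms] by blast
  have fin: "finite (in_system S First)" by (rule consistentD[OF assms(1)])
  have "card (in_system S' First) = card (in_system S First - comb) + a"
    unfolding sys using consistentD(2)[OF assms(1), of First] fin
    by (subst card_Un_disjoint) (auto simp: card_cartesian_product)
  moreover have "card (in_system S First - comb) + card comb = card (in_system S First)"
    using sub fin by (metis card_Diff_subset card_mono finite_subset le_add_diff_inverse2)
  ultimately show "backlog S' + min (pairs_waiting S) (pair_rate N) = backlog S + a"
    using card by (simp add: backlog_def)
  show "unreleased S' = (unreleased S - (1 + b) * a) + min (pairs_waiting S) (pair_rate N)"
    using unrel card by simp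
qed

lemma backlog_bounds:
  assumes "consistent N t S"
  shows "xlen S i \<le> backlog S"
    and "backlog S \<le> pairs_waiting S + (\<Sum>k\<in>UNIV. qlen S (Raw First) k) + (\<Sum>k\<in>UNIV. qlen S (Raw Second) (k::'v::finite))"
proof -
  note fin = consistentD(1,8,9)[OF assms]
  have sys: "in_system S First = in_system S i" for i by (rule consistentD(6)[OF assms, symmetric])
  show "xlen S i \<le> backlog S"
    unfolding backlog_def xlen_def sys[of i] by (auto intro!: card_mono fin simp: in_system_def)
  have "in_system S First \<subseteq> (arrived S First \<inter> arrived S Second) \<union> (\<Union>k. raw_at S First k) \<union> (\<Union>k. raw_at S Second k)"
    using sys[of Second] unfolding in_system_def by blast
  then have "backlog S \<le> card ((arrived S First \<inter> arrived S Second) \<union> (\<Union>k. raw_at S First k) \<union> (\<Union>k. raw_at S Second k))"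
    unfolding backlog_def by (intro card_mono) (auto intro: fin)
  also have "\<dots> \<le> card (arrived S First \<inter> arrived S Second) + card (\<Union>k. raw_at S First k) + card (\<Union>k. raw_at S Second k)"
    by (meson add_le_mono1 card_Un_le le_trans)
  also have "\<dots> \<le> pairs_waiting S + (\<Sum>k\<in>UNIV. qlen S (Raw First) k) + (\<Sum>k\<in>UNIV. qlen S (Raw Second) k)"
    unfolding pairs_waiting_def by (auto intro!: add_mono card_UN_le)
  finally show "backlog S \<le> pairs_waiting S + (\<Sum>k\<in>UNIV. qlen S (Raw First) k) + (\<Sum>k\<in>UNIV. qlen S (Raw Second) k)" .
qed

section \<open>Queue recursion and nodes that stay empty\<close>

definition external :: "'v network \<Rightarrow> nat \<Rightarrow> nat \<Rightarrow> cls \<Rightarrow> 'v \<Rightarrow> nat" where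
  "external N a b c k = (if k = cls_src N c then if c = Proc then (1 + b) * a else a else 0)"

text \<open>Only an upper bound: the receiver is credited with all offered service, although idle
  service moves nothing, and \<open>external\<close> also counts packets entering at their own
  destination, where the queue is kept at 0. The drift of the network queues rests on this recursion
  and on \<open>bp_choice\<close>.\<close>

lemma qlen_step:
  fixes N :: "'v::finite network"
  assumes c: "consistent N t S" and step: "pi2_step N t a b S S'"
  obtains best where "bp_choice N S best"
    and "\<And>c k. qlen S' c k \<le> qlen S c k - (\<Sum>j\<in>UNIV. bp_service N S best c k j)
           + (\<Sum>m\<in>UNIV. bp_service N S best c m k) + external N a b c k"
proof -
  from step obtain best M mv comb where "pi2_moves N t a b S S' best M mv comb"
    unfolding pi2_step_iff by blast
  note bp = pi2_movesD(1)[OF this] and sub = pi2_movesD(2)[OF this] and disj = pi2_movesD(3)[OF this]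
    and feas = pi2_movesD(4)[OF this] and mv = pi2_movesD(5)[OF this]
    and raw = pi2_movesD(8)[OF this] and proc = pi2_movesD(11)[OF this]
  have "qlen S' c k \<le> qlen S c k - (\<Sum>j\<in>UNIV. bp_service N S best c k j)
           + (\<Sum>m\<in>UNIV. bp_service N S best c m k) + external N a b c k" for c k
  proof (cases c)
    case Proc
    have "(\<Sum>m\<in>UNIV. mv m k) \<le> (\<Sum>m\<in>UNIV. bp_service N S best Proc m k)"
      using mv unfolding feasible_moves_def by (intro sum_mono) auto
    moreover have "(\<Sum>j\<in>UNIV. mv k j) = min (proc_at S k) (\<Sum>j\<in>UNIV. bp_service N S best Proc k j)"
      using mv unfolding feasible_moves_def by auto
    moreover have "p - min p u + i + x \<le> p - u + v + x" if "i \<le> v" for p u i v x :: nat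
    proof -
      have "p - min p u = p - u" by (simp add: min_def)
      with that show ?thesis by simp
    qed
    ultimately show ?thesis by (simp only: proc[of k] Proc qlen.simps) (auto simp: external_def)
  next
    case (Raw i)
    have fin: "finite (raw_at S i m)" for m by (rule consistentD[OF assms(1)])
    have finM: "finite (M i m j)" for m j using sub fin finite_subset by metis
    have out: "card (\<Union>j. M i k j) = (\<Sum>j\<in>UNIV. card (M i k j))"
      using disj[of i k] finM by (intro card_UN_disjoint) (auto simp: disjoint_family_on_def)
    have "card (raw_at S' i k) \<le> card ((raw_at S i k - (\<Union>j. M i k j)) \<union> (\<Union>m. M i m k) \<union>
               (if k = source N i then {t} \<times> {..<a} else {}))"
      using fin finM by (intro card_mono) (auto simp: raw)
    also have "\<dots> \<le> card (raw_at S i k - (\<Union>j. M i k j)) + card (\<Union>m. M i m k) +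
        card (if k = source N i then {t} \<times> {..<a} else {})"
      by (meson add_le_mono1 card_Un_le le_trans)
    also have "card (raw_at S i k - (\<Union>j. M i k j)) = card (raw_at S i k) - (\<Sum>j\<in>UNIV. card (M i k j))"
      using sub finM by (subst card_Diff_subset) (auto simp: out)
    also have "(\<Sum>j\<in>UNIV. card (M i k j)) = min (qlen S c k) (\<Sum>j\<in>UNIV. bp_service N S best c k j)"
      using feas[of i] Raw unfolding feasible_moves_def by auto
    finally have "card (raw_at S' i k) \<le> card (raw_at S i k) -
        min (qlen S c k) (\<Sum>j\<in>UNIV. bp_service N S best c k j) + card (\<Union>m. M i m k) +
        card (if k = source N i then {t} \<times> {..<a} else {})" .
    moreover have "card (\<Union>m. M i m k) \<le> (\<Sum>m\<in>UNIV. card (M i m k))"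
      by (rule card_UN_le) simp
    moreover have "\<dots> \<le> (\<Sum>m\<in>UNIV. bp_service N S best c m k)"
      using feas[of i] Raw unfolding feasible_moves_def by (intro sum_mono) auto
    moreover have "card (if k = source N i then {t} \<times> {..<a} else {}) = external N a b c k"
      using Raw by (auto simp: external_def card_cartesian_product)
    ultimately show ?thesis using Raw by simp
  qed
  with bp that show ?thesis by blast
qed

text \<open>A link of positive capacity never joins the component of the destination to its
  complement, and service needs a nonempty queue at the sender. All sources lie in the component, so
  neither neighbours nor arrivals feed the nodes outside it.\<close>

lemma unlinked_step:
  fixes N :: "'v::finite network"
  assumes N: "valid_network N" and c: "consistent N t S" and step: "pi2_step N t a b S S'"
    and src: "\<And>c. (cls_src N c, cls_dst N c) \<in> (links N)\<^sup>*"
    and zero: "\<And>c k. (k, cls_dst N c) \<notin> (links N)\<^sup>* \<Longrightarrow> qlen S c k = 0"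
    and k: "(k, cls_dst N c) \<notin> (links N)\<^sup>*"
  shows "qlen S' c k = 0"
proof -
  obtain best where step': "\<And>c k. qlen S' c k \<le> qlen S c k - (\<Sum>j\<in>UNIV. bp_service N S best c k j)
           + (\<Sum>m\<in>UNIV. bp_service N S best c m k) + external N a b c k"
    using qlen_step[OF c step] by metis
  have "bp_service N S best c m k = 0" for m
  proof (cases "(m, k) \<in> links N")
    case True
    then have "(m, cls_dst N c) \<notin> (links N)\<^sup>*"
      using k links_sym[OF N True] by (blast intro: converse_rtrancl_into_rtrancl)
    then show ?thesis using zero by (simp add: bp_service_def)
  qed (auto simp: bp_service_def links_def)
  moreover have "external N a b c k = 0" using src[of c] k by (auto simp: external_def)
  ultimately show ?thesis using step'[of c k] zero[OF k] by simp
qed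

section \<open>One-slot drift inequalities\<close>

definition total_cap :: "'v::finite network \<Rightarrow> nat" where
  "total_cap N = (\<Sum>m\<in>UNIV. \<Sum>k\<in>UNIV. cap N m k)"

lemma bp_service_le_cap: "bp_service N S best c m k \<le> cap N m k"
  by (simp add: bp_service_def)

lemma service_le_total_cap:
  fixes N :: "'v::finite network"
  shows "(\<Sum>j\<in>UNIV. bp_service N S best c k j) \<le> total_cap N"
    and "(\<Sum>m\<in>UNIV. bp_service N S best c m k) \<le> total_cap N"
proof -
  have "(\<Sum>j\<in>UNIV. bp_service N S best c k j) \<le> (\<Sum>j\<in>UNIV. cap N k j)"
    by (intro sum_mono bp_service_le_cap)
  also have "\<dots> \<le> total_cap N"
    unfolding total_cap_def by (rule member_le_sum[of k UNIV "\<lambda>m. \<Sum>j\<in>UNIV. cap N m j"]) auto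
  finally show "(\<Sum>j\<in>UNIV. bp_service N S best c k j) \<le> total_cap N" .
  have "bp_service N S best c m k \<le> (\<Sum>k\<in>UNIV. cap N m k)" for m
    using bp_service_le_cap member_le_sum[of k UNIV "\<lambda>k. cap N m k"] by (meson UNIV_I finite le_trans zero_le)
  then show "(\<Sum>m\<in>UNIV. bp_service N S best c m k) \<le> total_cap N"
    unfolding total_cap_def by (intro sum_mono)
qed

text \<open>Expands the square of the queue recursion, keeping the terms linear in \<open>q\<close>.
  For the constant, \<open>u\<close> contributes the square of \<open>K\<close>, and the square of
  \<open>K + 2 * a\<close> is at most twice the square of \<open>K\<close> plus eight times that of
  \<open>a\<close>.\<close>

lemma queue_square_step:
  fixes q u v :: nat
  assumes "q' \<le> q - u + v + x" and "u \<le> K" "v \<le> K" "x \<le> 2 * a"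
  shows "(real q')\<^sup>2 \<le> (real q)\<^sup>2 - 2 * (real q * (real u - real v)) + 2 * (real q * real x)
    + (3 * (real K)\<^sup>2 + 8 * (real a)\<^sup>2)"
proof -
  have "(real q')\<^sup>2 \<le> (real (q - u) + (real v + real x))\<^sup>2"
    using assms(1) by (intro power_mono) linarith+
  also have "\<dots> = (real (q - u))\<^sup>2 + 2 * (real (q - u) * (real v + real x)) + (real v + real x)\<^sup>2"
    by (simp add: power2_sum)
  also have "\<dots> \<le> (real q - real u)\<^sup>2 + 2 * (real q * (real v + real x)) + (real K + 2 * real a)\<^sup>2"
  proof (intro add_mono)
    show "(real (q - u))\<^sup>2 \<le> (real q - real u)\<^sup>2" by (cases "u \<le> q") auto
    show "2 * (real (q - u) * (real v + real x)) \<le> 2 * (real q * (real v + real x))"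
      by (intro mult_left_mono mult_right_mono) auto
    show "(real v + real x)\<^sup>2 \<le> (real K + 2 * real a)\<^sup>2"
      using assms(3,4) by (intro power_mono) linarith+
  qed
  also have "(real K + 2 * real a)\<^sup>2 \<le> 2 * (real K)\<^sup>2 + 8 * (real a)\<^sup>2"
    using sum_squares_bound[of "real K" "2 * real a"] by (simp add: power2_sum power_mult_distrib)
  also have "(real q - real u)\<^sup>2 \<le> (real q)\<^sup>2 - 2 * (real q * real u) + (real K)\<^sup>2"
    using power_mono[of "real u" "real K" 2] assms(2) by (simp add: power2_diff)
  finally show ?thesis by (simp add: algebra_simps)
qed

definition lyapunov :: "'v::finite state \<Rightarrow> real" where
  "lyapunov S = (\<Sum>c\<in>UNIV. \<Sum>k\<in>UNIV. (real (qlen S c k))\<^sup>2)"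

definition src_qlen :: "'v network \<Rightarrow> 'v state \<Rightarrow> cls \<Rightarrow> real" where
  "src_qlen N S c = real (qlen S c (cls_src N c))"

text \<open>Sum the squared recursions: the service terms give \<open>backlog_gap\<close> by
  \<open>bp_drift\<close>, and the input terms survive only at the sources. There are
  \<open>3 * CARD('v)\<close> queues, and a release is at most \<open>2 * a\<close> because
  \<open>b\<close> is at most 1.\<close>

lemma lyapunov_step:
  fixes N :: "'v::finite network"
  assumes N: "valid_network N" and c: "consistent N t S" and step: "pi2_step N t a b S S'" and b: "b \<le> 1"
  shows "lyapunov S' \<le> lyapunov S - backlog_gap N S
     + 2 * ((src_qlen N S (Raw First) + src_qlen N S (Raw Second)) * real a
            + src_qlen N S Proc * real ((1 + b) * a))
     + 3 * real CARD('v) * (3 * (real (total_cap N))\<^sup>2 + 8 * (real a)\<^sup>2)"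
proof -
  obtain best where bp: "bp_choice N S best" and step': "\<And>c k. qlen S' c k \<le> qlen S c k - (\<Sum>j\<in>UNIV. bp_service N S best c k j)
           + (\<Sum>m\<in>UNIV. bp_service N S best c m k) + external N a b c k"
    using qlen_step[OF c step] by metis
  define Q where "Q c k = real (qlen S c k)" for c k
  define u where "u c k = real (\<Sum>j\<in>UNIV. bp_service N S best c k j)" for c k
  define v where "v c k = real (\<Sum>m\<in>UNIV. bp_service N S best c m k)" for c k
  define x where "x c k = real (external N a b c k)" for c k
  define D where "D = 3 * (real (total_cap N))\<^sup>2 + 8 * (real a)\<^sup>2"
  have "external N a b c k \<le> 2 * a" for c k
    using mult_right_mono[of "1 + b" 2 a] b by (auto simp: external_def)
  then have "(real (qlen S' c k))\<^sup>2 \<le> (Q c k)\<^sup>2 - 2 * (Q c k * (u c k - v c k)) + 2 * (Q c k * x c k) + D" for c k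
    unfolding Q_def u_def v_def x_def D_def
    by (intro queue_square_step[OF step'] service_le_total_cap)
  then have "lyapunov S' \<le> (\<Sum>c\<in>UNIV. \<Sum>k\<in>UNIV. (Q c k)\<^sup>2 - 2 * (Q c k * (u c k - v c k)) + 2 * (Q c k * x c k) + D)"
    unfolding lyapunov_def by (intro sum_mono)
  also have "\<dots> = lyapunov S - 2 * (\<Sum>c\<in>UNIV. \<Sum>k\<in>UNIV. Q c k * (u c k - v c k)) + 2 * (\<Sum>c\<in>UNIV. \<Sum>k\<in>UNIV. Q c k * x c k)
      + 3 * real CARD('v) * D"
    by (simp add: sum.distrib sum_subtractf sum_distrib_left lyapunov_def Q_def UNIV_cls)
  also have "(\<Sum>c\<in>UNIV. \<Sum>k\<in>UNIV. Q c k * x c k) =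
      (src_qlen N S (Raw First) + src_qlen N S (Raw Second)) * real a + src_qlen N S Proc * real ((1 + b) * a)"
  proof -
    have "(\<Sum>k\<in>UNIV. Q c k * x c k) = src_qlen N S c * (if c = Proc then real ((1 + b) * a) else real a)" for c
    proof -
      have "(\<Sum>k\<in>UNIV. Q c k * x c k) =
          (\<Sum>k\<in>UNIV. if k = cls_src N c then src_qlen N S c * (if c = Proc then real ((1 + b) * a) else real a) else 0)"
        by (intro sum.cong) (auto simp: Q_def x_def external_def src_qlen_def)
      then show ?thesis by simp
    qed
    then show ?thesis unfolding sum_cls by (simp add: distrib_right)
  qed
  finally have "lyapunov S' \<le> lyapunov S - 2 * (\<Sum>c\<in>UNIV. \<Sum>k\<in>UNIV. Q c k * (u c k - v c k))
     + 2 * ((src_qlen N S (Raw First) + src_qlen N S (Raw Second)) * real a + src_qlen N S Proc * real ((1 + b) * a))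
      + 3 * real CARD('v) * D" .
  moreover have "backlog_gap N S \<le> 2 * (\<Sum>c\<in>UNIV. \<Sum>k\<in>UNIV. Q c k * (u c k - v c k))"
    using bp_drift[OF N bp] unfolding Q_def u_def v_def by simp
  ultimately show ?thesis unfolding D_def by linarith
qed

lemma backlog_square_step:
  fixes S :: "'v::finite state"
  assumes c: "consistent N t S" and step: "pi2_step N t a b S S'"
  shows "(real (backlog S'))\<^sup>2 \<le> (real (backlog S))\<^sup>2 + (real a)\<^sup>2 + 2 * (real (backlog S) * real a)
     - 2 * real (pair_rate N) * real (backlog S)
     + 2 * real (pair_rate N) * ((\<Sum>k\<in>UNIV. real (qlen S (Raw First) k)) + (\<Sum>k\<in>UNIV. real (qlen S (Raw Second) k)))
     + 3 * (real (pair_rate N))\<^sup>2"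
proof -
  define m C z R where "m = real (min (pairs_waiting S) (pair_rate N))" and "C = real (pair_rate N)"
    and "z = real (backlog S)"
    and "R = (\<Sum>k\<in>UNIV. real (qlen S (Raw First) k)) + (\<Sum>k\<in>UNIV. real (qlen S (Raw Second) k))"
  have m: "0 \<le> m" "m \<le> C" by (auto simp: m_def C_def)
  have R: "0 \<le> R" by (auto simp: R_def intro!: add_nonneg_nonneg sum_nonneg)
  have z': "real (backlog S') = z + real a - m"
    using backlog_step(1)[OF c step] unfolding z_def m_def by linarith
  have key: "z * (C - m) \<le> C * (C + R)"
  proof (cases "pair_rate N \<le> pairs_waiting S")
    case True
    then show ?thesis using R by (simp add: m_def C_def min_def)
  next
    case False
    have "real (backlog S) \<le> real (pairs_waiting S + (\<Sum>k\<in>UNIV. qlen S (Raw First) k) + (\<Sum>k\<in>UNIV. qlen S (Raw Second) k))"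
      using backlog_bounds(2)[OF c] by (subst of_nat_le_iff)
    then have "z \<le> C + R" using False unfolding z_def C_def R_def by simp
    moreover have "0 \<le> z" by (simp add: z_def)
    ultimately have "z * (C - m) \<le> (C + R) * C"
      using m by (intro mult_mono) auto
    then show ?thesis by (simp add: mult.commute)
  qed
  have "m\<^sup>2 \<le> C\<^sup>2" using m by (intro power_mono) auto
  moreover have "0 \<le> real a * m" using m by simp
  moreover have "(z + real a - m)\<^sup>2 = z\<^sup>2 + (real a)\<^sup>2 + m\<^sup>2 + 2 * (z * real a) - 2 * (z * m) - 2 * (real a * m)"
    by (simp add: power2_eq_square algebra_simps)
  moreover have "2 * (z * m) = 2 * C * z - 2 * (z * (C - m))" by (simp add: algebra_simps)
  moreover have "2 * (C * (C + R)) = 2 * C\<^sup>2 + 2 * C * R" by (simp add: power2_eq_square algebra_simps)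
  ultimately have "(z + real a - m)\<^sup>2 \<le> z\<^sup>2 + (real a)\<^sup>2 + 2 * (z * real a) - 2 * C * z + 2 * C * R + 3 * C\<^sup>2"
    using key by linarith
  then show ?thesis unfolding z' by (simp add: z_def C_def R_def)
qed

text \<open>Combining a pair takes one unit from \<open>backlog\<close> and adds one to
  \<open>unreleased\<close>, so their sum changes only through arrivals and the genuine releases
  \<open>min f (unreleased S)\<close>.\<close>

lemma pipeline_square_step:
  assumes c: "consistent N t S" and step: "pi2_step N t a b S S'" and b: "b \<le> 1"
  shows "(real (backlog S' + unreleased S'))\<^sup>2 \<le> (real (backlog S + unreleased S))\<^sup>2
     + 2 * (real (backlog S) * real a) + 2 * (real (unreleased S) * real a)
     - 2 * (real (unreleased S) * real ((1 + b) * a)) + 12 * (real a)\<^sup>2"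
    and "backlog S' + unreleased S' \<le> backlog S + unreleased S + a"
proof -
  define f where "f = (1 + b) * a"
  have f: "f \<le> 2 * a" using mult_right_mono[of "1 + b" 2 a] b by (auto simp: f_def)
  define z y x where "z = real (backlog S)" and "y = real (unreleased S)" and "x = real f"
  have w': "backlog S' + unreleased S' + min f (unreleased S) = backlog S + unreleased S + a"
    using backlog_step[OF c step] unfolding f_def by linarith
  then show "backlog S' + unreleased S' \<le> backlog S + unreleased S + a" by linarith
  define d where "d = real a - min x y"
  have x: "0 \<le> x" "x \<le> 2 * real a" using f unfolding x_def by linarith+
  have pos: "0 \<le> z" "0 \<le> y" by (auto simp: z_def y_def)
  have eq: "real (backlog S' + unreleased S') = z + y + d"
    using arg_cong[OF w', of real] unfolding z_def y_def x_def d_def by simp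
  \<comment> \<open>The genuine release falls short of \<open>x\<close> only if
    \<open>y < x\<close>, and then \<open>y * x\<close> is at most the square of \<open>x\<close>.
    Doubled, this costs 8 times the square of \<open>a\<close>; the square of \<open>d\<close> costs
    4 more, hence the constant 12.\<close>
  have "y * x - x\<^sup>2 \<le> y * min x y"
  proof (cases "x \<le> y")
    case False
    then have "y * x \<le> x * x" using x by (intro mult_right_mono) auto
    moreover have "0 \<le> y * y" using pos by simp
    moreover have "y * min x y = y * y" using False by simp
    ultimately show ?thesis unfolding power2_eq_square by linarith
  qed (simp add: power2_eq_square)
  moreover have "z * d \<le> z * real a" using x pos by (intro mult_left_mono) (auto simp: d_def)
  moreover have "d\<^sup>2 \<le> (2 * real a)\<^sup>2"
    using x pos by (intro abs_le_square_iff[THEN iffD1]) (auto simp: d_def)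
  moreover have "x\<^sup>2 \<le> (2 * real a)\<^sup>2" using x by (intro power_mono) auto
  moreover have "(2 * real a)\<^sup>2 = 4 * (real a)\<^sup>2" by (simp add: power_mult_distrib)
  moreover have "y * d = y * real a - y * min x y" by (simp add: d_def algebra_simps)
  moreover have "(z + y + d)\<^sup>2 = (z + y)\<^sup>2 + 2 * (z * d) + 2 * (y * d) + d\<^sup>2"
    by (simp add: power2_eq_square algebra_simps)
  ultimately have "(z + y + d)\<^sup>2 \<le> (z + y)\<^sup>2 + 2 * (z * real a) + 2 * (y * real a) - 2 * (y * x) + 12 * (real a)\<^sup>2"
    by linarith
  then show "(real (backlog S' + unreleased S'))\<^sup>2 \<le> (real (backlog S + unreleased S))\<^sup>2
     + 2 * (real (backlog S) * real a) + 2 * (real (unreleased S) * real a)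
     - 2 * (real (unreleased S) * real ((1 + b) * a)) + 12 * (real a)\<^sup>2"
    unfolding eq by (simp add: z_def y_def x_def f_def)
qed

lemma qlen_growth:
  fixes N :: "'v::finite network"
  assumes c: "consistent N t S" and step: "pi2_step N t a b S S'" and b: "b \<le> 1"
  shows "qlen S' c k \<le> qlen S c k + total_cap N + 2 * a"
proof -
  obtain best where step': "\<And>c k. qlen S' c k \<le> qlen S c k - (\<Sum>j\<in>UNIV. bp_service N S best c k j)
           + (\<Sum>m\<in>UNIV. bp_service N S best c m k) + external N a b c k"
    using qlen_step[OF c step] by metis
  have "external N a b c k \<le> 2 * a"
    using mult_right_mono[of "1 + b" 2 a] b by (auto simp: external_def)
  then show ?thesis
    using step'[of c k] service_le_total_cap(2)[where N = N and S = S and best = best and c = c and k = k]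
    by linarith
qed

section \<open>Time averages and expectations\<close>

text \<open>A bound for every \<open>T\<close> instead of a limsup: telescoping delivers it
  directly, and it is preserved by sums and nonnegative multiples.\<close>

definition avg_bounded :: "(nat \<Rightarrow> real) \<Rightarrow> bool" where
  "avg_bounded q \<longleftrightarrow> (\<exists>C. \<forall>T. (\<Sum>t<T. q t) \<le> C * real T)"

lemma avg_bounded_mono:
  assumes "avg_bounded q" "\<And>t. p t \<le> q t"
  shows "avg_bounded p"
  using assms sum_mono[of _ p q] unfolding avg_bounded_def by (meson order_trans)

lemma avg_bounded_add:
  assumes "avg_bounded p" "avg_bounded q"
  shows "avg_bounded (\<lambda>t. p t + q t)"
proof -
  obtain C D where "\<And>T. (\<Sum>t<T. p t) \<le> C * real T" "\<And>T. (\<Sum>t<T. q t) \<le> D * real T"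
    using assms unfolding avg_bounded_def by blast
  then have "(\<Sum>t<T. p t + q t) \<le> (C + D) * real T" for T
    using add_mono by (fastforce simp: sum.distrib distrib_right)
  then show ?thesis unfolding avg_bounded_def by blast
qed

lemma avg_bounded_cmult:
  assumes "avg_bounded q" "0 \<le> c"
  shows "avg_bounded (\<lambda>t. c * q t)"
proof -
  obtain C where "\<And>T. (\<Sum>t<T. q t) \<le> C * real T" using assms unfolding avg_bounded_def by blast
  then have "(\<Sum>t<T. c * q t) \<le> c * C * real T" for T
    using mult_left_mono[OF _ \<open>0 \<le> c\<close>, of "\<Sum>t<T. q t" "C * real T"] by (simp add: sum_distrib_left mult.assoc)
  then show ?thesis unfolding avg_bounded_def by blast
qed

lemma avg_bounded_sum:
  assumes "finite I" "\<And>i. i \<in> I \<Longrightarrow> avg_bounded (q i)"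
  shows "avg_bounded (\<lambda>t. \<Sum>i\<in>I. q i t)"
  using assms
proof (induction I rule: finite_induct)
  case empty
  have "avg_bounded (\<lambda>_. 0)" unfolding avg_bounded_def by (auto intro: exI[of _ 0])
  then show ?case by simp
qed (simp add: avg_bounded_add)

text \<open>Foster-Lyapunov criterion: telescope the drift from \<open>L 0 = 0\<close> and drop the
  nonnegative \<open>L T\<close>. The perturbation \<open>h\<close> lets one stability result feed
  the next.\<close>

lemma avg_bounded_drift:
  assumes L: "L 0 = 0" "\<And>t. 0 \<le> L t" and "0 < \<delta>" and h: "avg_bounded h"
    and drift: "\<And>t. L (Suc t) \<le> L t + b + h t - \<delta> * q t"
  shows "avg_bounded q"
proof -
  obtain C where C: "\<And>T. (\<Sum>t<T. h t) \<le> C * real T" using h unfolding avg_bounded_def by blast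
  have "L T + \<delta> * (\<Sum>t<T. q t) \<le> b * real T + (\<Sum>t<T. h t)" for T
  proof (induction T)
    case (Suc T)
    then show ?case using drift[of T] by (simp add: algebra_simps)
  qed (simp add: L)
  then have "\<delta> * (\<Sum>t<T. q t) \<le> (b + C) * real T" for T
    using C[of T] L(2)[of T] by (smt (verit) distrib_right)
  then have "(\<Sum>t<T. q t) \<le> (b + C) / \<delta> * real T" for T
    using \<open>0 < \<delta>\<close> by (simp add: field_simps)
  then show ?thesis unfolding avg_bounded_def by blast
qed

lemma strongly_stable_mono:
  assumes "strongly_stable M q" and "\<And>t \<omega>. \<omega> \<in> space M \<Longrightarrow> p t \<omega> \<le> q t \<omega>"
  shows "strongly_stable M p"
proof -
  have "limsup (\<lambda>T. (\<Sum>t = 1..T. \<integral>\<^sup>+\<omega>. of_nat (p t \<omega>) \<partial>M) / of_nat T)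
     \<le> limsup (\<lambda>T. (\<Sum>t = 1..T. \<integral>\<^sup>+\<omega>. of_nat (q t \<omega>) \<partial>M) / (of_nat T :: ennreal))"
    using assms(2)
    by (intro Limsup_mono always_eventually allI divide_right_mono_ennreal sum_mono nn_integral_mono) simp
  with assms(1) show ?thesis unfolding strongly_stable_def by (rule order.strict_trans1[rotated])
qed

lemma strongly_stableI:
  assumes int: "\<And>t. integrable M (\<lambda>\<omega>. real (q t \<omega>))"
    and avg: "avg_bounded (\<lambda>t. \<integral>\<omega>. real (q t \<omega>) \<partial>M)"
  shows "strongly_stable M q"
proof -
  let ?e = "\<lambda>t. \<integral>\<omega>. real (q t \<omega>) \<partial>M"
  obtain C where C: "\<And>T. (\<Sum>t<T. ?e t) \<le> C * real T" using avg unfolding avg_bounded_def by blast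
  have e0: "0 \<le> ?e t" for t by simp
  have "?e 0 \<le> C" using C[of 1] by simp
  with e0[of 0] have C0: "0 \<le> C" by (rule order_trans)
  have nn: "(\<integral>\<^sup>+\<omega>. of_nat (q t \<omega>) \<partial>M) = ennreal (?e t)" for t
    unfolding ennreal_of_nat_eq_real_of_nat by (intro nn_integral_eq_integral int) simp
  have "(\<Sum>t = 1..T. \<integral>\<^sup>+\<omega>. of_nat (q t \<omega>) \<partial>M) / of_nat T \<le> ennreal (2 * C)" if "1 \<le> T" for T
  proof -
    \<comment> \<open>The window \<open>1..T\<close> is enlarged to \<open>0..T\<close>; its
      \<open>T + 1\<close> terms are at most \<open>2 * T\<close> in number, hence the bound
      \<open>2 * C\<close>.\<close>
    have "(\<Sum>t = 1..T. ?e t) \<le> (\<Sum>t<Suc T. ?e t)"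
      by (intro sum_mono2) (auto simp: less_Suc_eq_le)
    also have "\<dots> \<le> C * real (Suc T)" by (rule C)
    also have "\<dots> \<le> C * (2 * real T)" using that C0 by (intro mult_left_mono) auto
    finally have "(\<Sum>t = 1..T. ?e t) / real T \<le> 2 * C" using that by (simp add: field_simps)
    moreover have "(\<Sum>t = 1..T. \<integral>\<^sup>+\<omega>. of_nat (q t \<omega>) \<partial>M) / of_nat T = ennreal ((\<Sum>t = 1..T. ?e t) / real T)"
      using that unfolding nn sum_ennreal[OF e0]
      by (subst ennreal_of_nat_eq_real_of_nat, subst divide_ennreal) (auto intro: sum_nonneg)
    ultimately show ?thesis by (simp add: ennreal_leI)
  qed
  then have "limsup (\<lambda>T. (\<Sum>t = 1..T. \<integral>\<^sup>+\<omega>. of_nat (q t \<omega>) \<partial>M) / of_nat T) \<le> ennreal (2 * C)"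
    by (intro Limsup_bounded) (auto simp: eventually_sequentially)
  then show ?thesis unfolding strongly_stable_def by (rule order.strict_trans1) simp
qed

section \<open>Measurability and square integrability\<close>

lemma measurable_card_countable:
  fixes X :: "'w \<Rightarrow> 'a::countable set"
  assumes [measurable]: "\<And>x. Measurable.pred G (\<lambda>\<omega>. x \<in> X \<omega>)"
  shows "(\<lambda>\<omega>. card (X \<omega>)) \<in> measurable G (count_space UNIV)"
proof -
  \<comment> \<open>The injection \<open>to_nat\<close> preserves cardinality and reduces the claim
    to sets of natural numbers.\<close>
  have "(\<lambda>\<omega>. card (to_nat ` X \<omega>)) \<in> measurable G (count_space UNIV)"
  proof (rule measurable_card)
    fix i
    have "{\<omega> \<in> space G. i \<in> to_nat ` X \<omega>} = {\<omega> \<in> space G. \<exists>x. to_nat x = i \<and> x \<in> X \<omega>}" by auto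
    also have "\<dots> \<in> sets G" by measurable
    finally show "{\<omega> \<in> space G. i \<in> to_nat ` X \<omega>} \<in> sets G" .
  qed
  then show ?thesis by (simp add: card_image)
qed

lemma integrable_square_add:
  fixes f g :: "'w \<Rightarrow> real"
  assumes [measurable]: "f \<in> borel_measurable M" "g \<in> borel_measurable M"
    and "integrable M (\<lambda>\<omega>. (f \<omega>)\<^sup>2)" "integrable M (\<lambda>\<omega>. (g \<omega>)\<^sup>2)"
  shows "integrable M (\<lambda>\<omega>. (f \<omega> + g \<omega>)\<^sup>2)"
proof (rule Bochner_Integration.integrable_bound)
  show "integrable M (\<lambda>\<omega>. 2 * (f \<omega>)\<^sup>2 + 2 * (g \<omega>)\<^sup>2)" using assms by auto
  show "AE \<omega> in M. norm ((f \<omega> + g \<omega>)\<^sup>2) \<le> norm (2 * (f \<omega>)\<^sup>2 + 2 * (g \<omega>)\<^sup>2)"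
  proof (rule AE_I2)
    fix \<omega>
    have "(f \<omega> + g \<omega>)\<^sup>2 \<le> 2 * (f \<omega>)\<^sup>2 + 2 * (g \<omega>)\<^sup>2"
      using sum_squares_bound[of "f \<omega>" "g \<omega>"] by (simp add: power2_sum)
    then show "norm ((f \<omega> + g \<omega>)\<^sup>2) \<le> norm (2 * (f \<omega>)\<^sup>2 + 2 * (g \<omega>)\<^sup>2)"
      by simp
  qed
qed simp

section \<open>Integrability and independence in the controlled system\<close>

context pi2_system
begin

text \<open>Pathwise majorant: up to a factor 2 and a deterministic term it dominates every queue,
  so square integrability is inherited from the arrivals.\<close>

definition arrivals :: "nat \<Rightarrow> 'w \<Rightarrow> nat" where
  "arrivals t \<omega> = (\<Sum>s<t. A s \<omega>)"

lemma A_measurable [measurable]: "A t \<in> measurable M (count_space UNIV)"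
  by (rule measurable_from_subalg[OF subalg A_adapted])

lemma B_measurable [measurable]: "B t \<in> measurable M (count_space UNIV)"
  by (rule measurable_from_subalg[OF subalg B_adapted])

lemma B_le: "\<omega> \<in> space M \<Longrightarrow> B t \<omega> \<le> 1"
  using B_range[of \<omega> t] by auto

lemma arrivals_measurable [measurable]: "(\<lambda>\<omega>. real (arrivals t \<omega>)) \<in> borel_measurable M"
  unfolding arrivals_def by measurable

lemma arrivals_square_integrable: "integrable M (\<lambda>\<omega>. (real (arrivals t \<omega>))\<^sup>2)"
proof (induction t)
  case (Suc t)
  have "integrable M (\<lambda>\<omega>. (real (arrivals t \<omega>) + real (A t \<omega>))\<^sup>2)"
    by (intro integrable_square_add Suc A_square_integrable) measurable
  then show ?case by (simp add: arrivals_def add.commute)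
qed (simp add: arrivals_def)

lemma A_integrable: "integrable M (\<lambda>\<omega>. real (A t \<omega>))"
  by (rule square_integrable_imp_integrable) (simp_all add: A_square_integrable)

lemma rate_nonneg: "0 \<le> rate"
  using A_mean[of 0] Bochner_Integration.integral_nonneg[of M "\<lambda>\<omega>. real (A 0 \<omega>)"] by simp

lemma A_square_mean: "expectation (\<lambda>\<omega>. (real (A t \<omega>))\<^sup>2) = expectation (\<lambda>\<omega>. (real (A 0 \<omega>))\<^sup>2)"
proof -
  have "expectation (\<lambda>\<omega>. (real (A t \<omega>))\<^sup>2) = (\<integral>x. (real x)\<^sup>2 \<partial>distr M (count_space UNIV) (A t))" for t
    by (rule integral_distr[symmetric]) auto
  then show ?thesis using A_ident[of t] by simp
qed

lemma consistent: "\<omega> \<in> space M \<Longrightarrow> consistent N t (S t \<omega>)"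
  by (induction t) (auto simp: initial consistent_empty intro: consistent_step(1) dynamics)

lemma queue_bounds:
  assumes \<omega>: "\<omega> \<in> space M"
  shows "qlen (S t \<omega>) c k \<le> t * total_cap N + 2 * arrivals t \<omega>"
    and "backlog (S t \<omega>) + unreleased (S t \<omega>) \<le> arrivals t \<omega>"
proof -
  show "qlen (S t \<omega>) c k \<le> t * total_cap N + 2 * arrivals t \<omega>"
  proof (induction t)
    case 0
    show ?case by (cases c) (auto simp: initial[OF \<omega>] empty_state_def)
  next
    case (Suc t)
    then show ?case
      using qlen_growth[OF consistent[OF \<omega>, of t] dynamics[OF \<omega>, of t] B_le[OF \<omega>], of c k]
      by (simp add: arrivals_def)
  qed
  show "backlog (S t \<omega>) + unreleased (S t \<omega>) \<le> arrivals t \<omega>"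
  proof (induction t)
    case 0
    show ?case by (simp add: initial[OF \<omega>] empty_state_def backlog_def in_system_def)
  next
    case (Suc t)
    then show ?case
      using pipeline_square_step(2)[OF consistent[OF \<omega>, of t] dynamics[OF \<omega>, of t] B_le[OF \<omega>]]
      by (simp add: arrivals_def)
  qed
qed

text \<open>Quantities known at the beginning of slot \<open>t\<close>, hence independent of
  \<open>A t\<close> and \<open>B t\<close>, with the moments that a quadratic drift
  requires.\<close>

definition adapted_sq :: "nat \<Rightarrow> ('w \<Rightarrow> real) \<Rightarrow> bool" where
  "adapted_sq t f \<longleftrightarrow> f \<in> borel_measurable (F t) \<and> integrable M (\<lambda>\<omega>. (f \<omega>)\<^sup>2)"

lemma adapted_sqD:
  assumes "adapted_sq t f"
  shows "f \<in> borel_measurable M" and "integrable M f" and "integrable M (\<lambda>\<omega>. (f \<omega>)\<^sup>2)"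
proof -
  show m: "f \<in> borel_measurable M"
    using assms measurable_from_subalg[OF subalg] by (auto simp: adapted_sq_def)
  show "integrable M (\<lambda>\<omega>. (f \<omega>)\<^sup>2)" using assms by (simp add: adapted_sq_def)
  with m show "integrable M f" by (rule square_integrable_imp_integrable)
qed

lemma adapted_sqI:
  assumes f: "f \<in> borel_measurable (F t)"
    and bound: "\<And>\<omega>. \<omega> \<in> space M \<Longrightarrow> 0 \<le> f \<omega> \<and> f \<omega> \<le> K + 2 * real (arrivals t \<omega>)"
  shows "adapted_sq t f"
proof -
  have [measurable]: "f \<in> borel_measurable M" by (rule measurable_from_subalg[OF subalg f])
  have "integrable M (\<lambda>\<omega>. (f \<omega>)\<^sup>2)"
  proof (rule Bochner_Integration.integrable_bound)
    have "integrable M (\<lambda>\<omega>. (2 * real (arrivals t \<omega>))\<^sup>2)"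
      using arrivals_square_integrable[of t] by (simp add: power_mult_distrib)
    then show "integrable M (\<lambda>\<omega>. (K + 2 * real (arrivals t \<omega>))\<^sup>2)"
      by (intro integrable_square_add) auto
    show "AE \<omega> in M. norm ((f \<omega>)\<^sup>2) \<le> norm ((K + 2 * real (arrivals t \<omega>))\<^sup>2)"
      using bound by (intro AE_I2) (simp add: power_mono)
  qed simp
  with f show ?thesis by (simp add: adapted_sq_def)
qed

lemma qlen_measurable: "(\<lambda>\<omega>. real (qlen (S t \<omega>) c k)) \<in> borel_measurable (F t)"
proof -
  have "(\<lambda>\<omega>. qlen (S t \<omega>) c k) \<in> measurable (F t) (count_space UNIV)"
    using proc_adapted raw_adapted by (cases c) (auto intro!: measurable_card_countable)
  then show ?thesis by simp
qed

lemma qlen_adapted: "adapted_sq t (\<lambda>\<omega>. real (qlen (S t \<omega>) c k))"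
proof (rule adapted_sqI[OF qlen_measurable, of _ _ _ "real (t * total_cap N)"])
  fix \<omega> assume "\<omega> \<in> space M"
  from queue_bounds(1)[OF this, of t c k]
  have "real (qlen (S t \<omega>) c k) \<le> real (t * total_cap N + 2 * arrivals t \<omega>)" by (simp only: of_nat_le_iff)
  then show "0 \<le> real (qlen (S t \<omega>) c k) \<and> real (qlen (S t \<omega>) c k) \<le> real (t * total_cap N) + 2 * real (arrivals t \<omega>)"
    by simp
qed

lemma backlog_adapted: "adapted_sq t (\<lambda>\<omega>. real (backlog (S t \<omega>)))"
proof (rule adapted_sqI[of _ _ 0])
  have [measurable]: "Measurable.pred (F t) (\<lambda>\<omega>. x \<in> raw_at (S t \<omega>) i k)"
    "Measurable.pred (F t) (\<lambda>\<omega>. x \<in> arrived (S t \<omega>) i)" for x i k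
    by (rule raw_adapted arrived_adapted)+
  have "Measurable.pred (F t) (\<lambda>\<omega>. (\<exists>k. x \<in> raw_at (S t \<omega>) First k) \<or> x \<in> arrived (S t \<omega>) First)" for x
    by measurable
  then have "(\<lambda>\<omega>. backlog (S t \<omega>)) \<in> measurable (F t) (count_space UNIV)"
    unfolding backlog_def by (intro measurable_card_countable) (simp add: in_system_def)
  then show "(\<lambda>\<omega>. real (backlog (S t \<omega>))) \<in> borel_measurable (F t)" by simp
qed (use queue_bounds(2)[of _ t] in \<open>fastforce simp flip: of_nat_add\<close>)

lemma unreleased_adapted_sq: "adapted_sq t (\<lambda>\<omega>. real (unreleased (S t \<omega>)))"
proof (rule adapted_sqI[of _ _ 0])
  show "(\<lambda>\<omega>. real (unreleased (S t \<omega>))) \<in> borel_measurable (F t)"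
    using unreleased_adapted[of t] by simp
qed (use queue_bounds(2)[of _ t] in \<open>fastforce simp flip: of_nat_add\<close>)

text \<open>The sigma-algebra of \<open>f\<close> lies in \<open>F t\<close>, and that of any
  function of the pair lies in the vimage algebra of the pair, whose values carry the discrete
  sigma-algebra. The independence \<open>fresh\<close> passes to these smaller
  sigma-algebras.\<close>

lemma indep_arrival:
  fixes f :: "'w \<Rightarrow> real" and g :: "nat \<times> nat \<Rightarrow> real"
  assumes f: "f \<in> borel_measurable (F t)"
  shows "indep_var borel f borel (\<lambda>\<omega>. g (A t \<omega>, B t \<omega>))"
proof -
  let ?X = "\<lambda>\<omega>. (A t \<omega>, B t \<omega>)" and ?N = "count_space UNIV :: (nat \<times> nat) measure"
  let ?V = "vimage_algebra (space M) ?X ?N"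
  have "?X \<in> measurable M (count_space UNIV \<Otimes>\<^sub>M count_space UNIV)" by measurable
  then have "?X \<in> measurable M ?N" by (simp add: pair_measure_countable)
  then have gX: "(\<lambda>\<omega>. g (?X \<omega>)) \<in> borel_measurable M"
    by (rule measurable_compose) simp
  have sp: "space (F t) = space M" using subalg[of t] by (simp add: subalgebra_def)
  have "sigma_sets (space M) {f -` Z \<inter> space M |Z. Z \<in> sets borel} \<subseteq> sets (F t)"
    using f sp sets.sigma_sets_subset[of "{f -` Z \<inter> space M |Z. Z \<in> sets borel}" "F t"]
    by (auto simp: measurable_def)
  moreover have "sigma_sets (space M) {(\<lambda>\<omega>. g (?X \<omega>)) -` Z \<inter> space M |Z. Z \<in> sets borel} \<subseteq> sets ?V"
  proof -
    have "(\<lambda>\<omega>. g (?X \<omega>)) -` Z \<inter> space M = ?X -` (g -` Z) \<inter> space M" for Z by auto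
    then have "{(\<lambda>\<omega>. g (?X \<omega>)) -` Z \<inter> space M |Z. Z \<in> sets borel} \<subseteq> sets ?V"
      by (auto intro!: in_vimage_algebra)
    then show ?thesis using sets.sigma_sets_subset[of _ ?V] by simp
  qed
  ultimately have "indep_set (sigma_sets (space M) {f -` Z \<inter> space M |Z. Z \<in> sets borel})
      (sigma_sets (space M) {(\<lambda>\<omega>. g (?X \<omega>)) -` Z \<inter> space M |Z. Z \<in> sets borel})"
    using fresh[of t] unfolding indep_sets2_eq by (meson subset_iff order_trans)
  then show ?thesis
    unfolding indep_var_eq using gX measurable_from_subalg[OF subalg f] by simp
qed

lemma
  shows B_integrable: "integrable M (\<lambda>\<omega>. real (B t \<omega>))"
    and B_mean: "expectation (\<lambda>\<omega>. real (B t \<omega>)) = eps"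
proof -
  have eq: "real (B t \<omega>) = indicator {\<omega> \<in> space M. B t \<omega> = 1} \<omega>" if "\<omega> \<in> space M" for \<omega>
    using B_range[OF that, of t] that by auto
  have meas: "{\<omega> \<in> space M. B t \<omega> = 1} \<in> events" by measurable
  show "integrable M (\<lambda>\<omega>. real (B t \<omega>))"
    using meas by (subst Bochner_Integration.integrable_cong[OF refl eq]) (auto simp: integrable_real_indicator emeasure_eq_measure)
  have "expectation (\<lambda>\<omega>. real (B t \<omega>)) = expectation (indicator {\<omega> \<in> space M. B t \<omega> = 1})"
    by (rule Bochner_Integration.integral_cong[OF refl eq])
  also have "\<dots> = eps" using meas B_prob[of t] by simp
  finally show "expectation (\<lambda>\<omega>. real (B t \<omega>)) = eps" .
qed

text \<open>The independence of \<open>A t\<close> and \<open>B t\<close> within a slot factorizes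
  the mean of the extra release, which yields the factor \<open>1 + eps\<close>.\<close>

lemma
  shows release_integrable: "integrable M (\<lambda>\<omega>. real ((1 + B t \<omega>) * A t \<omega>))"
    and release_mean: "expectation (\<lambda>\<omega>. real ((1 + B t \<omega>) * A t \<omega>)) = (1 + eps) * rate"
proof -
  have ind: "indep_var borel (\<lambda>\<omega>. real (A t \<omega>)) borel (\<lambda>\<omega>. real (B t \<omega>))"
    using indep_var_compose[OF A_indep_B[of t], of real borel real borel] by (simp add: comp_def)
  have int: "integrable M (\<lambda>\<omega>. real (A t \<omega>) * real (B t \<omega>))"
    by (rule indep_var_integrable[OF ind A_integrable B_integrable])
  have eq: "real ((1 + B t \<omega>) * A t \<omega>) = real (A t \<omega>) + real (A t \<omega>) * real (B t \<omega>)" for \<omega>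
    by (simp add: algebra_simps)
  show "integrable M (\<lambda>\<omega>. real ((1 + B t \<omega>) * A t \<omega>))"
    unfolding eq using int A_integrable by simp
  show "expectation (\<lambda>\<omega>. real ((1 + B t \<omega>) * A t \<omega>)) = (1 + eps) * rate"
    unfolding eq using int A_integrable indep_var_lebesgue_integral[OF ind A_integrable B_integrable]
    by (simp add: A_mean B_mean algebra_simps)
qed

text \<open>In the cross terms of the drift the inputs of a slot may be replaced by their means. The
  release is treated like the arrivals: dummy packets fix it at \<open>(1 + B t) * A t\<close>,
  however many processed packets are at hand.\<close>

lemma
  assumes "adapted_sq t f"
  shows arrival_integrable: "integrable M (\<lambda>\<omega>. f \<omega> * real (A t \<omega>))"
    and arrival_mean: "expectation (\<lambda>\<omega>. f \<omega> * real (A t \<omega>)) = expectation f * rate"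
    and release_mult_integrable: "integrable M (\<lambda>\<omega>. f \<omega> * real ((1 + B t \<omega>) * A t \<omega>))"
    and release_mult_mean: "expectation (\<lambda>\<omega>. f \<omega> * real ((1 + B t \<omega>) * A t \<omega>)) = expectation f * ((1 + eps) * rate)"
proof -
  have f: "f \<in> borel_measurable (F t)" using assms by (simp add: adapted_sq_def)
  note int = adapted_sqD(2)[OF assms]
  have 1: "indep_var borel f borel (\<lambda>\<omega>. real (A t \<omega>))"
    using indep_arrival[OF f, of "\<lambda>(a, b). real a"] by simp
  have 2: "indep_var borel f borel (\<lambda>\<omega>. real ((1 + B t \<omega>) * A t \<omega>))"
    using indep_arrival[OF f, of "\<lambda>(a, b). real ((1 + b) * a)"] by (simp only: prod.case)
  show "integrable M (\<lambda>\<omega>. f \<omega> * real (A t \<omega>))"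
    by (rule indep_var_integrable[OF 1 int A_integrable])
  show "expectation (\<lambda>\<omega>. f \<omega> * real (A t \<omega>)) = expectation f * rate"
    using indep_var_lebesgue_integral[OF 1 int A_integrable] by (simp add: A_mean)
  show "integrable M (\<lambda>\<omega>. f \<omega> * real ((1 + B t \<omega>) * A t \<omega>))"
    by (rule indep_var_integrable[OF 2 int release_integrable])
  show "expectation (\<lambda>\<omega>. f \<omega> * real ((1 + B t \<omega>) * A t \<omega>)) = expectation f * ((1 + eps) * rate)"
    using indep_var_lebesgue_integral[OF 2 int release_integrable] by (simp only: release_mean)
qed

lemma unlinked:
  assumes "\<omega> \<in> space M" and "\<And>c. (cls_src N c, cls_dst N c) \<in> (links N)\<^sup>*"
  shows "(k, cls_dst N c) \<notin> (links N)\<^sup>* \<Longrightarrow> qlen (S t \<omega>) c k = 0"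
proof (induction t arbitrary: c k)
  case 0
  show ?case by (cases c) (auto simp: initial[OF assms(1)] empty_state_def)
next
  case (Suc t)
  show ?case
    by (rule unlinked_step[OF network consistent[OF assms(1)] dynamics[OF assms(1)] assms(2) Suc.IH Suc.prems])
qed

section \<open>Stability\<close>

lemma lyapunov_integrable: "integrable M (\<lambda>\<omega>. lyapunov (S t \<omega>))"
  unfolding lyapunov_def by (intro Bochner_Integration.integrable_sum adapted_sqD(3)[OF qlen_adapted])

lemma backlog_gap_integrable: "integrable M (\<lambda>\<omega>. backlog_gap N (S t \<omega>))"
proof -
  have *: "integrable M (\<lambda>\<omega>. real (qlen (S t \<omega>) c k))" for c k
    by (rule adapted_sqD(2)[OF qlen_adapted])
  have "integrable M (\<lambda>\<omega>. weight (S t \<omega>) m k)" for m k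
    unfolding weight_def
    by (intro integrable_max integrable_abs Bochner_Integration.integrable_diff *)
  then show ?thesis
    unfolding backlog_gap_def by (simp add: case_prod_beta)
qed

section \<open>Time averages for a feasible flow rate above the release rate\<close>

context
  fixes r :: real
  assumes region: "(\<lambda>_. r) \<in> region N" and r: "(1 + eps) * rate < r" and eps: "0 < eps"
begin

lemma r_pos: "0 < r"
  using r rate_nonneg eps by (smt (verit) mult_nonneg_nonneg)

text \<open>The inputs act only at the sources, at rate at most \<open>\<rho>\<close> per class. The
  flow of rate \<open>r\<close> bounds their positive drift by the fraction
  \<open>\<rho> / r\<close> of the gap, and the fraction \<open>1 - \<rho> / r\<close> remains as
  negative drift.\<close>

lemma avg_bounded_backlog_gap: "avg_bounded (\<lambda>t. expectation (\<lambda>\<omega>. backlog_gap N (S t \<omega>)))"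
proof -
  define \<rho> where "\<rho> = (1 + eps) * rate"
  define a2 where "a2 = expectation (\<lambda>\<omega>. (real (A 0 \<omega>))\<^sup>2)"
  define K where "K = 3 * real CARD('v)"
  define b where "b = K * (3 * (real (total_cap N))\<^sup>2 + 8 * a2)"
  define L where "L t = expectation (\<lambda>\<omega>. lyapunov (S t \<omega>))" for t
  define G where "G t = expectation (\<lambda>\<omega>. backlog_gap N (S t \<omega>))" for t
  define s where "s t c = expectation (\<lambda>\<omega>. src_qlen N (S t \<omega>) c)" for t c
  have \<rho>: "rate \<le> \<rho>" "0 \<le> \<rho>" using rate_nonneg eps by (auto simp: \<rho>_def algebra_simps)
  have src: "adapted_sq t (\<lambda>\<omega>. src_qlen N (S t \<omega>) c)" for t c
    unfolding src_qlen_def by (rule qlen_adapted)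
  note int = lyapunov_integrable backlog_gap_integrable arrival_integrable[OF src]
    release_mult_integrable[OF src] A_square_integrable
  have step: "L (Suc t) \<le> L t - G t + 2 * ((s t (Raw First) + s t (Raw Second)) * rate + s t Proc * \<rho>) + b" for t
  proof -
    let ?R = "\<lambda>\<omega>. lyapunov (S t \<omega>) - backlog_gap N (S t \<omega>)
       + 2 * (src_qlen N (S t \<omega>) (Raw First) * real (A t \<omega>) + src_qlen N (S t \<omega>) (Raw Second) * real (A t \<omega>)
            + src_qlen N (S t \<omega>) Proc * real ((1 + B t \<omega>) * A t \<omega>))
       + K * (3 * (real (total_cap N))\<^sup>2 + 8 * (real (A t \<omega>))\<^sup>2)"
    have "L (Suc t) \<le> expectation ?R"
      unfolding L_def
    proof (rule integral_mono[OF lyapunov_integrable])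
      show "integrable M ?R"
        by (intro Bochner_Integration.integrable_add Bochner_Integration.integrable_diff
            Bochner_Integration.integrable_mult_right int) simp_all
      fix \<omega> assume \<omega>: "\<omega> \<in> space M"
      show "lyapunov (S (Suc t) \<omega>) \<le> ?R \<omega>"
        using lyapunov_step[OF network consistent[OF \<omega>] dynamics[OF \<omega>] B_le[OF \<omega>]]
        unfolding K_def distrib_right by simp
    qed
    also have "expectation ?R = L t - G t
       + 2 * (s t (Raw First) * rate + s t (Raw Second) * rate + s t Proc * \<rho>) + b"
      using int prob_space
      by (simp add: L_def G_def s_def \<rho>_def b_def a2_def arrival_mean[OF src] release_mult_mean[OF src] A_square_mean[of t] del: of_nat_mult of_nat_add One_nat_def plus_1_eq_Suc)
    finally show ?thesis by (simp add: distrib_right)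
  qed
  have flow: "2 * \<rho> * (s t (Raw First) + s t (Raw Second) + s t Proc) \<le> \<rho> / r * G t" for t
  proof -
    have "2 * r * (s t (Raw First) + s t (Raw Second) + s t Proc) =
        expectation (\<lambda>\<omega>. 2 * r * (src_qlen N (S t \<omega>) (Raw First) + src_qlen N (S t \<omega>) (Raw Second) + src_qlen N (S t \<omega>) Proc))"
      using adapted_sqD(2)[OF src] by (simp add: s_def)
    also have "\<dots> \<le> G t"
      unfolding G_def
    proof (rule integral_mono[OF _ backlog_gap_integrable])
      show "integrable M (\<lambda>\<omega>. 2 * r * (src_qlen N (S t \<omega>) (Raw First) + src_qlen N (S t \<omega>) (Raw Second) + src_qlen N (S t \<omega>) Proc))"
        using adapted_sqD(2)[OF src] by simp
      fix \<omega> assume \<omega>: "\<omega> \<in> space M"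
      show "2 * r * (src_qlen N (S t \<omega>) (Raw First) + src_qlen N (S t \<omega>) (Raw Second) + src_qlen N (S t \<omega>) Proc)
          \<le> backlog_gap N (S t \<omega>)"
        unfolding backlog_gap_def src_qlen_def
        by (rule flow_le_weight[OF network region, of "\<lambda>c k. real (qlen (S t \<omega>) c k)", unfolded sum_cls])
           (simp_all only: qlen_dst[OF consistent[OF \<omega>]] qlen_diff_le_weight of_nat_0)
    qed
    finally have "\<rho> / r * (2 * r * (s t (Raw First) + s t (Raw Second) + s t Proc)) \<le> \<rho> / r * G t"
      using \<rho> r_pos by (intro mult_left_mono) auto
    moreover have "\<rho> / r * (2 * r * x) = 2 * \<rho> * x" for x using r_pos by simp
    ultimately show ?thesis by simp
  qed
  have "avg_bounded G"
  proof (rule avg_bounded_drift)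
    show "L 0 = 0"
    proof -
      have "lyapunov (S 0 \<omega>) = 0" if "\<omega> \<in> space M" for \<omega>
        using that by (simp add: initial lyapunov_def sum_cls empty_state_def)
      then show ?thesis unfolding L_def by (simp cong: Bochner_Integration.integral_cong)
    qed
    show "0 \<le> L t" for t by (auto simp: L_def lyapunov_def intro!: Bochner_Integration.integral_nonneg sum_nonneg)
    show "0 < 1 - \<rho> / r" using r r_pos by (simp add: \<rho>_def)
    show "avg_bounded (\<lambda>_. 0)" unfolding avg_bounded_def by (auto intro: exI[of _ 0])
    fix t
    have s0: "0 \<le> s t c" for c by (auto simp: s_def src_qlen_def intro!: Bochner_Integration.integral_nonneg)
    \<comment> \<open>Raw packets arrive at \<open>rate\<close> only; raising this to
      \<open>\<rho>\<close> allows the flow bound, which has one common rate, to be applied to all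
      three classes.\<close>
    have "(s t (Raw First) + s t (Raw Second)) * rate \<le> (s t (Raw First) + s t (Raw Second)) * \<rho>"
      using s0 \<rho> by (intro mult_left_mono) (auto intro: add_nonneg_nonneg)
    with step[of t] flow[of t] show "L (Suc t) \<le> L t + b + 0 - (1 - \<rho> / r) * G t"
      by (simp add: algebra_simps)
  qed
  then show ?thesis by (simp add: G_def[abs_def])
qed

text \<open>Along a path to the destination the gap bounds the queue, with one \<open>n\<close> for
  all slots and outcomes; without a path the queue is always empty and \<open>n = 0\<close>
  serves.\<close>

lemma avg_bounded_qlen: "avg_bounded (\<lambda>t. expectation (\<lambda>\<omega>. real (qlen (S t \<omega>) c k)))"
proof -
  note linked = source_linked[OF network region r_pos]
  obtain n :: nat where n: "\<And>t \<omega>. \<omega> \<in> space M \<Longrightarrow> real (qlen (S t \<omega>) c k) \<le> real n * backlog_gap N (S t \<omega>)"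
  proof (cases "(k, cls_dst N c) \<in> (links N)\<^sup>*")
    case True
    obtain n :: nat where n: "\<And>q w. q (cls_dst N c) = 0 \<Longrightarrow> (\<And>m k. \<bar>q m - q k\<bar> \<le> w m k) \<Longrightarrow>
      q k \<le> real n * (\<Sum>(m, k)\<in>edges N. real (cap N m k) * w m k)"
      using linked_le_weight[OF True] by blast
    have "real (qlen (S t \<omega>) c k) \<le> real n * backlog_gap N (S t \<omega>)" if "\<omega> \<in> space M" for t \<omega>
      unfolding backlog_gap_def
      by (rule n[of "\<lambda>k. real (qlen (S t \<omega>) c k)"])
         (simp_all add: qlen_dst[OF consistent[OF that]] qlen_diff_le_weight)
    then show ?thesis by (rule that)
  next
    case False
    then show ?thesis using unlinked[OF _ linked] by (intro that[of 0]) simp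
  qed
  show ?thesis
  proof (rule avg_bounded_mono)
    show "avg_bounded (\<lambda>t. real n * expectation (\<lambda>\<omega>. backlog_gap N (S t \<omega>)))"
      by (intro avg_bounded_cmult avg_bounded_backlog_gap) simp
    fix t
    have "expectation (\<lambda>\<omega>. real (qlen (S t \<omega>) c k)) \<le> expectation (\<lambda>\<omega>. real n * backlog_gap N (S t \<omega>))"
      by (intro integral_mono adapted_sqD(2)[OF qlen_adapted] integrable_mult_right backlog_gap_integrable n)
    then show "expectation (\<lambda>\<omega>. real (qlen (S t \<omega>) c k)) \<le> real n * expectation (\<lambda>\<omega>. backlog_gap N (S t \<omega>))"
      by simp
  qed
qed

text \<open>The spare computing rate \<open>pair_rate N - rate\<close> supplies the negative drift;
  the raw queues enter as a perturbation whose averages are already bounded.\<close>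

lemma avg_bounded_backlog:
  assumes "rate < real (pair_rate N)"
  shows "avg_bounded (\<lambda>t. expectation (\<lambda>\<omega>. real (backlog (S t \<omega>))))"
proof -
  define a2 where "a2 = expectation (\<lambda>\<omega>. (real (A 0 \<omega>))\<^sup>2)"
  define C where "C = real (pair_rate N)"
  define L where "L t = expectation (\<lambda>\<omega>. (real (backlog (S t \<omega>)))\<^sup>2)" for t
  define Z where "Z t = expectation (\<lambda>\<omega>. real (backlog (S t \<omega>)))" for t
  define R where "R t = (\<Sum>k\<in>UNIV. expectation (\<lambda>\<omega>. real (qlen (S t \<omega>) (Raw First) k)))
     + (\<Sum>k\<in>UNIV. expectation (\<lambda>\<omega>. real (qlen (S t \<omega>) (Raw Second) k)))" for t
  note intq = adapted_sqD(2)[OF qlen_adapted]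
  note int = A_square_integrable adapted_sqD(2,3)[OF backlog_adapted] arrival_integrable[OF backlog_adapted]
  have step: "L (Suc t) \<le> L t + a2 + 2 * (Z t * rate) - 2 * C * Z t + 2 * C * R t + 3 * C\<^sup>2" for t
  proof -
    let ?R = "\<lambda>\<omega>. (real (backlog (S t \<omega>)))\<^sup>2 + (real (A t \<omega>))\<^sup>2 + 2 * (real (backlog (S t \<omega>)) * real (A t \<omega>))
     - 2 * C * real (backlog (S t \<omega>))
     + 2 * C * ((\<Sum>k\<in>UNIV. real (qlen (S t \<omega>) (Raw First) k)) + (\<Sum>k\<in>UNIV. real (qlen (S t \<omega>) (Raw Second) k)))
     + 3 * C\<^sup>2"
    have "L (Suc t) \<le> expectation ?R"
      unfolding L_def
    proof (rule integral_mono)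
      show "integrable M (\<lambda>\<omega>. (real (backlog (S (Suc t) \<omega>)))\<^sup>2)" by (rule int)
      show "integrable M ?R"
        by (intro Bochner_Integration.integrable_add Bochner_Integration.integrable_diff
            Bochner_Integration.integrable_mult_right Bochner_Integration.integrable_sum int intq) simp_all
      fix \<omega> assume \<omega>: "\<omega> \<in> space M"
      show "(real (backlog (S (Suc t) \<omega>)))\<^sup>2 \<le> ?R \<omega>"
        using backlog_square_step[OF consistent[OF \<omega>] dynamics[OF \<omega>]] by (simp add: C_def)
    qed
    also have "expectation ?R = L t + a2 + 2 * (Z t * rate) - 2 * C * Z t + 2 * C * R t + 3 * C\<^sup>2"
      using int intq prob_space
      by (simp add: L_def Z_def R_def a2_def arrival_mean[OF backlog_adapted] A_square_mean[of t] del: qlen.simps)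
    finally show ?thesis .
  qed
  have "avg_bounded Z"
  proof (rule avg_bounded_drift)
    show "L 0 = 0"
    proof -
      have "real (backlog (S 0 \<omega>)) = 0" if "\<omega> \<in> space M" for \<omega>
        using that by (simp add: initial backlog_def in_system_def empty_state_def)
      then show ?thesis unfolding L_def by (simp cong: Bochner_Integration.integral_cong)
    qed
    show "0 \<le> L t" for t by (simp add: L_def)
    show "0 < 2 * (C - rate)" using assms by (simp add: C_def)
    show "avg_bounded (\<lambda>t. 2 * C * R t)"
      unfolding R_def by (intro avg_bounded_cmult avg_bounded_add avg_bounded_sum avg_bounded_qlen) (simp_all add: C_def)
    show "L (Suc t) \<le> L t + (a2 + 3 * C\<^sup>2) + 2 * C * R t - 2 * (C - rate) * Z t" for t
      using step[of t] by (simp add: algebra_simps)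
  qed
  then show ?thesis by (simp add: Z_def[abs_def])
qed

text \<open>The inflow of \<open>unreleased\<close> depends on the state through the complete pairs;
  adding \<open>backlog\<close> cancels this internal transfer. Releases exceed arrivals by the
  factor \<open>1 + eps\<close> in the mean, whence the margin \<open>2 * eps * rate\<close>; the
  backlog is the perturbation.\<close>

lemma avg_bounded_unreleased:
  assumes "rate < real (pair_rate N)"
  shows "avg_bounded (\<lambda>t. expectation (\<lambda>\<omega>. real (unreleased (S t \<omega>))))"
proof (cases "rate = 0")
  case True \<comment> \<open>The drift term in \<open>unreleased\<close> vanishes, but almost surely nothing ever arrives.\<close>
  have "expectation (\<lambda>\<omega>. real (unreleased (S t \<omega>))) \<le> 0" for t
  proof -
    have arr: "integrable M (\<lambda>\<omega>. real (arrivals t \<omega>))"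
      unfolding arrivals_def of_nat_sum by (intro Bochner_Integration.integrable_sum A_integrable)
    have "expectation (\<lambda>\<omega>. real (unreleased (S t \<omega>))) \<le> expectation (\<lambda>\<omega>. real (arrivals t \<omega>))"
    proof (rule integral_mono[OF adapted_sqD(2)[OF unreleased_adapted_sq] arr])
      fix \<omega> assume "\<omega> \<in> space M"
      then show "real (unreleased (S t \<omega>)) \<le> real (arrivals t \<omega>)"
        using queue_bounds(2)[of \<omega> t] by linarith
    qed
    also have "\<dots> = 0"
      unfolding arrivals_def of_nat_sum using A_mean True A_integrable by simp
    finally show ?thesis .
  qed
  moreover have "avg_bounded (\<lambda>_. 0)" unfolding avg_bounded_def by (auto intro: exI[of _ 0])
  ultimately show ?thesis by (rule avg_bounded_mono[rotated])
next
  case False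
  define a2 where "a2 = expectation (\<lambda>\<omega>. (real (A 0 \<omega>))\<^sup>2)"
  define W where "W t \<omega> = (real (backlog (S t \<omega>) + unreleased (S t \<omega>)))\<^sup>2" for t \<omega>
  define Z where "Z t = expectation (\<lambda>\<omega>. real (backlog (S t \<omega>)))" for t
  define Y where "Y t = expectation (\<lambda>\<omega>. real (unreleased (S t \<omega>)))" for t
  have W: "integrable M (W t)" for t
    unfolding W_def of_nat_add
    by (intro integrable_square_add adapted_sqD[OF backlog_adapted] adapted_sqD[OF unreleased_adapted_sq])
  note int = W A_square_integrable arrival_integrable[OF backlog_adapted] arrival_integrable[OF unreleased_adapted_sq]
    release_mult_integrable[OF unreleased_adapted_sq]
  have step: "expectation (W (Suc t)) \<le> expectation (W t) + 2 * (Z t * rate) + 2 * (Y t * rate)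
      - 2 * (Y t * ((1 + eps) * rate)) + 12 * a2" for t
  proof -
    let ?R = "\<lambda>\<omega>. W t \<omega> + 2 * (real (backlog (S t \<omega>)) * real (A t \<omega>)) + 2 * (real (unreleased (S t \<omega>)) * real (A t \<omega>))
     - 2 * (real (unreleased (S t \<omega>)) * real ((1 + B t \<omega>) * A t \<omega>)) + 12 * (real (A t \<omega>))\<^sup>2"
    have "expectation (W (Suc t)) \<le> expectation ?R"
    proof (rule integral_mono[OF W])
      show "integrable M ?R"
        by (intro Bochner_Integration.integrable_add Bochner_Integration.integrable_diff
            Bochner_Integration.integrable_mult_right int)
      fix \<omega> assume \<omega>: "\<omega> \<in> space M"
      show "W (Suc t) \<omega> \<le> ?R \<omega>"
        using pipeline_square_step(1)[OF consistent[OF \<omega>] dynamics[OF \<omega>] B_le[OF \<omega>]] unfolding W_def .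
    qed
    also have "expectation ?R = expectation (W t) + 2 * (Z t * rate) + 2 * (Y t * rate)
      - 2 * (Y t * ((1 + eps) * rate)) + 12 * a2"
      using int
      by (simp add: Z_def Y_def a2_def arrival_mean[OF backlog_adapted] arrival_mean[OF unreleased_adapted_sq]
          release_mult_mean[OF unreleased_adapted_sq] A_square_mean[of t] del: of_nat_mult of_nat_add One_nat_def plus_1_eq_Suc)
    finally show ?thesis .
  qed
  have "avg_bounded Y"
  proof (rule avg_bounded_drift)
    show "expectation (W 0) = 0"
    proof -
      have "W 0 \<omega> = 0" if "\<omega> \<in> space M" for \<omega>
        using that by (simp add: W_def initial backlog_def in_system_def empty_state_def)
      then show ?thesis by (simp cong: Bochner_Integration.integral_cong)
    qed
    show "0 \<le> expectation (W t)" for t by (simp add: W_def)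
    show "0 < 2 * eps * rate" using eps rate_nonneg False by simp
    show "avg_bounded (\<lambda>t. 2 * rate * Z t)"
      unfolding Z_def by (intro avg_bounded_cmult avg_bounded_backlog assms) (simp add: rate_nonneg)
    show "expectation (W (Suc t)) \<le> expectation (W t) + 12 * a2 + 2 * rate * Z t - 2 * eps * rate * Y t" for t
      using step[of t] by (simp add: algebra_simps)
  qed
  then show ?thesis by (simp add: Y_def[abs_def])
qed

lemma stable_of_feasible_rate:
  assumes "rate < real (pair_rate N)"
  shows "system_stable M S"
  unfolding system_stable_def
proof (intro conjI allI)
  show "strongly_stable M (\<lambda>t \<omega>. qlen (S t \<omega>) c k)" for c k
    by (rule strongly_stableI[OF adapted_sqD(2)[OF qlen_adapted] avg_bounded_qlen])
  show "strongly_stable M (\<lambda>t \<omega>. xlen (S t \<omega>) i)" for i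
    by (rule strongly_stable_mono[OF strongly_stableI[OF adapted_sqD(2)[OF backlog_adapted] avg_bounded_backlog[OF assms]]])
       (rule backlog_bounds(1)[OF consistent])
  show "strongly_stable M (\<lambda>t \<omega>. ylen (S t \<omega>))"
    unfolding ylen_def
    by (rule strongly_stableI[OF adapted_sqD(2)[OF unreleased_adapted_sq] avg_bounded_unreleased[OF assms]])
qed

end

end

text \<open>Makes the set under the supremum in \<open>max_rate\<close> nonempty.\<close>

lemma zero_in_region: "(\<lambda>_. 0) \<in> region N"
  unfolding flow_region_def by (auto intro!: exI[of _ "\<lambda>_ _ _. 0"])

theorem theorem3:
  fixes M :: "'w measure"
    and F :: "nat \<Rightarrow> 'w measure"
    and N :: "'v::finite network"
    and rate eps :: real
    and A B :: "nat \<Rightarrow> 'w \<Rightarrow> nat"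
    and S :: "nat \<Rightarrow> 'w \<Rightarrow> 'v state"
  assumes "0 < eps" and "eps < 1"
    and "pi2_system M F N rate eps A B S"
    and "rate < (1 - eps / (1 + eps)) * max_rate N"
  shows "system_stable M S"
proof -
  interpret pi2_system M F N rate eps A B S by fact
  \<comment> \<open>The factor in the rate condition is the reciprocal of \<open>1 + eps\<close>:
    the released stream, dummies included, has rate \<open>(1 + eps) * rate\<close> and has to fit
    below \<open>max_rate N\<close>.\<close>
  have "(1 - eps / (1 + eps)) = 1 / (1 + eps)" using \<open>0 < eps\<close> by (simp add: field_simps)
  then have "(1 + eps) * rate < max_rate N" using assms(1,4) by (simp add: field_simps)
  moreover have "0 \<in> {r. 0 \<le> r \<and> (\<lambda>_. r) \<in> region N \<and> r \<le> real (pair_rate N)}"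
    using zero_in_region[of N] by simp
  then have "{r. 0 \<le> r \<and> (\<lambda>_. r) \<in> region N \<and> r \<le> real (pair_rate N)} \<noteq> {}" by blast
  ultimately obtain r where r: "(1 + eps) * rate < r" "(\<lambda>_. r) \<in> region N" "r \<le> real (pair_rate N)"
    unfolding max_rate_def by (blast elim: less_cSupE)
  \<comment> \<open>The same \<open>r\<close> keeps the arrival rate strictly below the computing
    rate, because \<open>r\<close> is at most \<open>pair_rate N\<close>.\<close>
  have "rate \<le> (1 + eps) * rate" using \<open>0 < eps\<close> rate_nonneg by (simp add: algebra_simps)
  then show ?thesis
    using r \<open>0 < eps\<close> by (intro stable_of_feasible_rate) auto
qed

end
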